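(* Let $p,q\ge 2$ be integers. There is a tight chiral polyhedron of type $\{p, q\}$ and one of type $\{q, p\}$ under any of the following conditions: (a) $q$ is odd, $p$ is an even divisor of $2q$, and there is an odd prime $m$ such that $m$ divides $p$ and $m^2$ divides $q$; (b) $p$ and $q$ are both even, and there is an odd prime $m$ such that $m$ divides $p$ and $m^2$ divides $q$; (c) $p$ is divisible by $8$ and $q$ is divisible by $32$.
   Context: An (abstract) polyhedron is a partially ordered set whose elements have rank $0$ (vertices), $1$ (edges) or $2$ (faces), where two elements are incident if they are comparable, such that: every edge is incident to exactly two vertices and two faces; whenever a vertex is incident to a face there are exactly two edges incident to both; the graph of the incidence relation is connected; and for every vertex or face $F$, the subgraph of the incidence graph induced on the neighbours of $F$ is connected. A flag is a mutually incident triple (vertex, edge, face); for a flag $\Phi$ and $i\in\{0,1,2\}$, $\Phi^i$ denotes the unique flag differing from $\Phi$ exactly in its rank-$i$ element. The polyhedron has type (Schläfli symbol) $\{p,q\}$ if every face is incident to exactly $p$ edges and every vertex to exactly $q$ edges. An automorphism is an incidence-preserving bijection. The polyhedron is chiral if its flags can be split into two classes such that flags $\Phi$ and $\Phi^i$ always lie in different classes and the automorphism group acts transitively on each class but not on all flags. A polyhedron of type $\{p,q\}$ has at least $2pq$ flags; it is called tight if it has exactly $2pq$ flags. *)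

theory Defs
  imports Main "HOL-Computational_Algebra.Primes"
begin

record 'a ranked_poset =
  elems :: "'a set"
  ord :: "'a rel"
  rk :: "'a \<Rightarrow> nat"

text \<open>An element is not counted as incident to itself, so the neighbours of \<open>x\<close> in the
  incidence graph are the \<open>y\<close> with \<^term>\<open>incident P x y\<close>.\<close>

definition incident :: "'a ranked_poset \<Rightarrow> 'a \<Rightarrow> 'a \<Rightarrow> bool" where
  "incident P x y \<longleftrightarrow> x \<in> elems P \<and> y \<in> elems P \<and> x \<noteq> y \<and> ((x, y) \<in> ord P \<or> (y, x) \<in> ord P)"

definition vertices :: "'a ranked_poset \<Rightarrow> 'a set" where
  "vertices P = {x \<in> elems P. rk P x = 0}"

definition edges :: "'a ranked_poset \<Rightarrow> 'a set" where
  "edges P = {x \<in> elems P. rk P x = 1}"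

definition faces :: "'a ranked_poset \<Rightarrow> 'a set" where
  "faces P = {x \<in> elems P. rk P x = 2}"

definition incidence_connected :: "'a ranked_poset \<Rightarrow> 'a set \<Rightarrow> bool" where
  "incidence_connected P S \<longleftrightarrow>
     S \<noteq> {} \<and> (\<forall>x\<in>S. \<forall>y\<in>S. (x, y) \<in> {(a, b). a \<in> S \<and> b \<in> S \<and> incident P a b}\<^sup>*)"

definition polyhedron :: "'a ranked_poset \<Rightarrow> bool" where
  "polyhedron P \<longleftrightarrow>
     partial_order_on (elems P) (ord P) \<and>
     (\<forall>x\<in>elems P. rk P x \<in> {0, 1, 2}) \<and>
     (\<forall>x y. (x, y) \<in> ord P \<and> x \<noteq> y \<longrightarrow> rk P x < rk P y) \<and>
     (\<forall>e\<in>edges P. card {v \<in> vertices P. incident P e v} = 2 \<and>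
                  card {f \<in> faces P. incident P e f} = 2) \<and>
     (\<forall>v\<in>vertices P. \<forall>f\<in>faces P. incident P v f \<longrightarrow>
        card {e \<in> edges P. incident P e v \<and> incident P e f} = 2) \<and>
     incidence_connected P (elems P) \<and>
     (\<forall>x \<in> vertices P \<union> faces P. incidence_connected P {y. incident P x y})"

definition has_type :: "'a ranked_poset \<Rightarrow> nat \<Rightarrow> nat \<Rightarrow> bool" where
  "has_type P p q \<longleftrightarrow>
     (\<forall>f\<in>faces P. card {e \<in> edges P. incident P e f} = p) \<and>
     (\<forall>v\<in>vertices P. card {e \<in> edges P. incident P e v} = q)"

type_synonym 'a flag = "'a \<times> 'a \<times> 'a"

definition flags :: "'a ranked_poset \<Rightarrow> 'a flag set" where
  "flags P = {(v, e, f). v \<in> vertices P \<and> e \<in> edges P \<and> f \<in> faces P \<and>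
                         incident P v e \<and> incident P e f \<and> incident P v f}"

fun flag_elem :: "'a flag \<Rightarrow> nat \<Rightarrow> 'a" where
  "flag_elem (v, e, f) i = (if i = 0 then v else if i = 1 then e else f)"

definition adjacent_flags :: "'a ranked_poset \<Rightarrow> nat \<Rightarrow> 'a flag \<Rightarrow> 'a flag \<Rightarrow> bool" where
  "adjacent_flags P i \<Phi> \<Psi> \<longleftrightarrow>
     \<Phi> \<in> flags P \<and> \<Psi> \<in> flags P \<and> {j \<in> {0, 1, 2}. flag_elem \<Phi> j \<noteq> flag_elem \<Psi> j} = {i}"

definition flag_adj :: "'a ranked_poset \<Rightarrow> nat \<Rightarrow> 'a flag \<Rightarrow> 'a flag" where
  "flag_adj P i \<Phi> = (THE \<Psi>. adjacent_flags P i \<Phi> \<Psi>)"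

text \<open>Preservation of rank excludes dualities, which preserve incidence as well.\<close>

definition automorphisms :: "'a ranked_poset \<Rightarrow> ('a \<Rightarrow> 'a) set" where
  "automorphisms P = {g. bij_betw g (elems P) (elems P) \<and>
     (\<forall>x\<in>elems P. rk P (g x) = rk P x) \<and>
     (\<forall>x\<in>elems P. \<forall>y\<in>elems P. incident P (g x) (g y) \<longleftrightarrow> incident P x y)}"

definition flag_map :: "('a \<Rightarrow> 'a) \<Rightarrow> 'a flag \<Rightarrow> 'a flag" where
  "flag_map g = map_prod g (map_prod g g)"

definition aut_transitive_on :: "'a ranked_poset \<Rightarrow> 'a flag set \<Rightarrow> bool" where
  "aut_transitive_on P C \<longleftrightarrow> (\<forall>\<Phi>\<in>C. \<forall>\<Psi>\<in>C. \<exists>g\<in>automorphisms P. flag_map g \<Phi> = \<Psi>)"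

definition chiral :: "'a ranked_poset \<Rightarrow> bool" where
  "chiral P \<longleftrightarrow>
     (\<exists>C D. C \<union> D = flags P \<and> C \<inter> D = {} \<and>
        (\<forall>\<Phi>\<in>flags P. \<forall>i\<in>{0, 1, 2}. \<Phi> \<in> C \<longleftrightarrow> flag_adj P i \<Phi> \<in> D) \<and>
        aut_transitive_on P C \<and> aut_transitive_on P D) \<and>
     \<not> aut_transitive_on P (flags P)"

text \<open>Since \<^term>\<open>card\<close> is 0 on infinite sets, for positive \<open>p\<close> and \<open>q\<close> the flag count
  forces the flag set to be finite and nonempty.\<close>

definition tight_chiral_polyhedron :: "'a ranked_poset \<Rightarrow> nat \<Rightarrow> nat \<Rightarrow> bool" where
  "tight_chiral_polyhedron P p q \<longleftrightarrow>
     polyhedron P \<and> has_type P p q \<and> chiral P \<and> card (flags P) = 2 * p * q"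

lemma card_2_ex1_other:
  assumes "card A = 2" "x \<in> A"
  shows "\<exists>!y. y \<in> A \<and> y \<noteq> x"
  using assms by (auto simp: card_2_iff)

lemma flag_adj_ex1:
  assumes P: "polyhedron P" and \<Phi>: "\<Phi> \<in> flags P" and i: "i \<in> {0, 1, 2}"
  shows "\<exists>!\<Psi>. adjacent_flags P i \<Phi> \<Psi>"
proof -
  obtain v e f where \<Phi>_eq: "\<Phi> = (v, e, f)" by (cases \<Phi>)
  have F: "v \<in> vertices P" "e \<in> edges P" "f \<in> faces P"
    "incident P v e" "incident P e f" "incident P v f"
    using \<Phi> by (auto simp: \<Phi>_eq flags_def)
  have tr: "trans (ord P)"
    using P partial_order_onD(2) unfolding polyhedron_def by blast
  have mono: "\<And>x y. (x, y) \<in> ord P \<Longrightarrow> x \<noteq> y \<Longrightarrow> rk P x < rk P y"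
    using P unfolding polyhedron_def by blast
  have vert2: "card {v \<in> vertices P. incident P e v} = 2"
    and face2: "card {f \<in> faces P. incident P e f} = 2"
    and edge2: "card {e \<in> edges P. incident P e v \<and> incident P e f} = 2"
    using P F unfolding polyhedron_def by blast+
  have less: "(x, y) \<in> ord P" if "incident P x y" "rk P x < rk P y" for x y
    using that mono[of y x] unfolding incident_def by auto
  have sym: "incident P y x" if "incident P x y" for x y
    using that unfolding incident_def by blast
  have comp: "incident P w g" if "incident P e w" "incident P e g" "w \<in> vertices P" "g \<in> faces P" for w g
  proof -
    have "(w, e) \<in> ord P" "(e, g) \<in> ord P"
      using that F(2) less[of w e] less[of e g] sym[OF that(1)]
      by (simp_all add: vertices_def edges_def faces_def)
    then have "(w, g) \<in> ord P" using tr by (meson transD)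
    then show ?thesis using that by (auto simp: incident_def vertices_def faces_def)
  qed
  have ex0: "\<exists>!w. w \<in> {v \<in> vertices P. incident P e v} \<and> w \<noteq> v"
    using vert2 F sym[OF F(4)] by (intro card_2_ex1_other) blast+
  have ex1: "\<exists>!w. w \<in> {e \<in> edges P. incident P e v \<and> incident P e f} \<and> w \<noteq> e"
    using edge2 F sym[OF F(4)] by (intro card_2_ex1_other) blast+
  have ex2: "\<exists>!w. w \<in> {f \<in> faces P. incident P e f} \<and> w \<noteq> f"
    using face2 F by (intro card_2_ex1_other) blast+
  have diff: "{j \<in> {0, 1, 2}. flag_elem \<Phi> j \<noteq> flag_elem (v', e', f') j} = {i} \<longleftrightarrow>
      (v' \<noteq> v \<longleftrightarrow> i = 0) \<and> (e' \<noteq> e \<longleftrightarrow> i = 1) \<and> (f' \<noteq> f \<longleftrightarrow> i = 2)" for v' e' f'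
  proof -
    have *: "{j \<in> A. Q j} = {i} \<longleftrightarrow> (\<forall>j\<in>A. Q j \<longleftrightarrow> j = i)" if "i \<in> A" for A Q
      using that by auto
    show ?thesis unfolding *[OF i] by (auto simp: \<Phi>_eq)
  qed
  have adj: "adjacent_flags P i \<Phi> (v', e', f') \<longleftrightarrow> (v', e', f') \<in> flags P \<and>
      (v' \<noteq> v \<longleftrightarrow> i = 0) \<and> (e' \<noteq> e \<longleftrightarrow> i = 1) \<and> (f' \<noteq> f \<longleftrightarrow> i = 2)" for v' e' f'
    unfolding adjacent_flags_def diff using \<Phi> by blast
  have flag: "(v', e', f') \<in> flags P \<longleftrightarrow> v' \<in> vertices P \<and> e' \<in> edges P \<and> f' \<in> faces P \<and>
      incident P v' e' \<and> incident P e' f' \<and> incident P v' f'" for v' e' f'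
    by (simp add: flags_def)
  consider "i = 0" | "i = 1" | "i = 2" using i by auto
  then show ?thesis
  proof cases
    case 1
    then have adj0: "adjacent_flags P i \<Phi> (v', e', f') \<longleftrightarrow>
        (v', e', f') \<in> flags P \<and> v' \<noteq> v \<and> e' = e \<and> f' = f" for v' e' f'
      unfolding adj by simp
    obtain w where w: "w \<in> vertices P" "incident P e w" "w \<noteq> v"
      "\<And>u. u \<in> vertices P \<Longrightarrow> incident P e u \<Longrightarrow> u \<noteq> v \<Longrightarrow> u = w"
      using ex0 by blast
    have "adjacent_flags P i \<Phi> (w, e, f)"
      unfolding adj0 flag using w(1-3) F sym[OF w(2)] comp[OF w(2) F(5) w(1) F(3)] by blast
    moreover have "\<Psi> = (w, e, f)" if "adjacent_flags P i \<Phi> \<Psi>" for \<Psi>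
    proof (cases \<Psi>)
      case (fields v' e' f')
      show ?thesis using that w(4)[of v'] sym[of v' e] unfolding fields adj0 flag by blast
    qed
    ultimately show ?thesis by (rule ex1I)
  next
    case 2
    then have adj1: "adjacent_flags P i \<Phi> (v', e', f') \<longleftrightarrow>
        (v', e', f') \<in> flags P \<and> v' = v \<and> e' \<noteq> e \<and> f' = f" for v' e' f'
      unfolding adj by simp
    obtain w where w: "w \<in> edges P" "incident P w v" "incident P w f" "w \<noteq> e"
      "\<And>u. u \<in> edges P \<Longrightarrow> incident P u v \<Longrightarrow> incident P u f \<Longrightarrow> u \<noteq> e \<Longrightarrow> u = w"
      using ex1 by blast
    have "adjacent_flags P i \<Phi> (v, w, f)"
      unfolding adj1 flag using w(1-4) F sym[OF w(2)] by blast
    moreover have "\<Psi> = (v, w, f)" if "adjacent_flags P i \<Phi> \<Psi>" for \<Psi>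
    proof (cases \<Psi>)
      case (fields v' e' f')
      show ?thesis using that w(5)[of e'] sym[of v e'] unfolding fields adj1 flag by blast
    qed
    ultimately show ?thesis by (rule ex1I)
  next
    case 3
    then have adj2: "adjacent_flags P i \<Phi> (v', e', f') \<longleftrightarrow>
        (v', e', f') \<in> flags P \<and> v' = v \<and> e' = e \<and> f' \<noteq> f" for v' e' f'
      unfolding adj by simp
    obtain w where w: "w \<in> faces P" "incident P e w" "w \<noteq> f"
      "\<And>u. u \<in> faces P \<Longrightarrow> incident P e u \<Longrightarrow> u \<noteq> f \<Longrightarrow> u = w"
      using ex2 by blast
    have "adjacent_flags P i \<Phi> (v, e, w)"
      unfolding adj2 flag using w(1-3) F comp[OF sym[OF F(4)] w(2) F(1) w(1)] by blast
    moreover have "\<Psi> = (v, e, w)" if "adjacent_flags P i \<Phi> \<Psi>" for \<Psi>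
    proof (cases \<Psi>)
      case (fields v' e' f')
      show ?thesis using that w(4)[of f'] unfolding fields adj2 flag by blast
    qed
    ultimately show ?thesis by (rule ex1I)
  qed
qed

end

theory Submission
  imports Defs "HOL-Algebra.Multiplicative_Group"
begin

text \<open>
  Let $G = \<langle>a\<rangle>\<langle>b\<rangle>$ be a finite group with $(ab)^2 = 1$ and
  $\<langle>a\<rangle> \<inter> \<langle>b\<rangle> = 1$, where $a$ and $b$ have order $p$ and $q$. The left cosets of
  $\<langle>b\<rangle>$, $\<langle>ab\<rangle>$ and $\<langle>a\<rangle>$ are the vertices, edges and faces of a tight polyhedron of
  type $\{p, q\}$ on which $G$ acts with two orbits of flags. An automorphism joining the orbits
  would induce an automorphism of $G$ inverting $a$ and $b$, so the polyhedron is chiral as soon as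
  some relation between $a$ and $b$ fails for $a^{-1}$ and $b^{-1}$. Replacing $(a, b)$ by
  $(b^{-1}, a^{-1})$ gives the dual polyhedron.

  The groups are quotients of one infinite group $\Gamma$. It contains a Heisenberg group generated
  by $b$ and $y$ with $z = [y, b]$ central, and $ab$ acts on it by exchanging $b$ and $y b^{-1}$,
  which inverts $z$. Inverting $b$ and $y b^{-1}$ instead fixes $z$, whereas a relation
  $z = b^Q y^{-j}$, which is compatible with the exchange if $y^{Q - 2j} = 1$, would become
  $z^{-1} = b^Q y^{-j}$; hence the quotient is chiral if $z$ has order $n > 2$. This works with
  $n = m$ in the first two cases and $n = 4$ in the last one. The remaining prime factors of $p$
  and $q$ are supplied by the group of pairs $(u, v)$ with
  $(u, v)(u', v') = (u + (-1)^v u', v + (-1)^u v')$.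
\<close>

section \<open>The polyhedron of cosets\<close>

text \<open>\<open>a\<close> and \<open>b\<close> play the rotations about a base face and a base
  vertex, and \<open>a \<otimes> b\<close> the half-turn about a base edge.
  \<open>factorization\<close> will make every vertex incident to every face.\<close>

locale rotation_group = group G for G (structure) +
  fixes a b
  assumes a_closed [simp, intro]: "a \<in> carrier G" and b_closed [simp, intro]: "b \<in> carrier G"
    and fin: "finite (carrier G)"
    and a_nontrivial: "a \<noteq> \<one>" and b_nontrivial: "b \<noteq> \<one>"
    and involution: "(a \<otimes> b) \<otimes> (a \<otimes> b) = \<one>"
    and trivial_inter: "generate G {a} \<inter> generate G {b} = {\<one>}"
    and factorization: "g \<in> carrier G \<Longrightarrow> \<exists>\<alpha>\<in>generate G {a}. \<exists>\<beta>\<in>generate G {b}. g = \<alpha> \<otimes> \<beta>"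
begin

abbreviation "A \<equiv> generate G {a}"
abbreviation "B \<equiv> generate G {b}"
abbreviation "t \<equiv> a \<otimes> b"

lemma subgroup_A: "subgroup A G" and subgroup_B: "subgroup B G"
  by (auto intro!: generate_is_subgroup)

lemma A_closed [simp, intro]: "x \<in> A \<Longrightarrow> x \<in> carrier G"
  and B_closed [simp, intro]: "x \<in> B \<Longrightarrow> x \<in> carrier G"
  using subgroup.mem_carrier subgroup_A subgroup_B by metis+

lemma a_in_A [simp]: "a \<in> A" and b_in_B [simp]: "b \<in> B"
  by (auto intro: generate.incl)

lemma A_group [simp, intro]:
  "\<one> \<in> A" "x \<in> A \<Longrightarrow> inv x \<in> A" "x \<in> A \<Longrightarrow> y \<in> A \<Longrightarrow> x \<otimes> y \<in> A"
  using subgroup_A by (auto simp: subgroup.m_inv_closed subgroup.m_closed subgroup.one_closed)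

lemma B_group [simp, intro]:
  "\<one> \<in> B" "x \<in> B \<Longrightarrow> inv x \<in> B" "x \<in> B \<Longrightarrow> y \<in> B \<Longrightarrow> x \<otimes> y \<in> B"
  using subgroup_B by (auto simp: subgroup.m_inv_closed subgroup.m_closed subgroup.one_closed)

lemma A_pow [simp, intro]: "a [^] (n::nat) \<in> A" and B_pow [simp, intro]: "b [^] (n::nat) \<in> B"
  by (induction n) auto

lemma A_B_unique: "x \<in> A \<Longrightarrow> x \<in> B \<Longrightarrow> x = \<one>"
  using trivial_inter by blast

lemma a_notin_B: "a \<notin> B" and b_notin_A: "b \<notin> A"
  using A_B_unique a_in_A b_in_B a_nontrivial b_nontrivial by blast+

lemma t_notin_A: "t \<notin> A"
proof
  assume "t \<in> A"
  then have "inv a \<otimes> t \<in> A" by auto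
  then show False using b_notin_A by (simp add: m_assoc[symmetric])
qed

lemma t_notin_B: "t \<notin> B"
proof
  assume "t \<in> B"
  then have "t \<otimes> inv b \<in> B" by auto
  then show False using a_notin_B by (simp add: m_assoc)
qed

lemma inv_t: "inv t = t"
  using involution by (simp add: inv_equality)

lemma t_eq: "t = inv b \<otimes> inv a"
  using inv_t inv_mult_group[of a b] by simp

lemma b_a_b: "b \<otimes> t = inv a"
proof -
  have "b \<otimes> t = b \<otimes> (inv b \<otimes> inv a)" by (simp only: t_eq)
  then show ?thesis by (simp add: m_assoc[symmetric])
qed

text \<open>Inverting a factorization of \<open>inv g\<close> reverses the order of its
  factors.\<close>

lemma factorization': "g \<in> carrier G \<Longrightarrow> \<exists>\<beta>\<in>B. \<exists>\<alpha>\<in>A. g = \<beta> \<otimes> \<alpha>"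
proof -
  assume g: "g \<in> carrier G"
  then obtain \<alpha> \<beta> where *: "\<alpha> \<in> A" "\<beta> \<in> B" "inv g = \<alpha> \<otimes> \<beta>"
    using factorization[of "inv g"] by auto
  then have "g = inv \<beta> \<otimes> inv \<alpha>" using g by (metis A_closed B_closed inv_inv inv_mult_group)
  then show ?thesis using * by blast
qed

end

section \<open>Incidence of cosets, coded as natural numbers whose residue modulo 3 is the
  rank\<close>

locale coset_polyhedron = rotation_group +
  fixes V E F :: "'a \<Rightarrow> nat"
  assumes V_eq: "x \<in> carrier G \<Longrightarrow> y \<in> carrier G \<Longrightarrow> V x = V y \<longleftrightarrow> inv x \<otimes> y \<in> B"
    and E_eq: "x \<in> carrier G \<Longrightarrow> y \<in> carrier G \<Longrightarrow> E x = E y \<longleftrightarrow> inv x \<otimes> y \<in> {\<one>, t}"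
    and F_eq: "x \<in> carrier G \<Longrightarrow> y \<in> carrier G \<Longrightarrow> F x = F y \<longleftrightarrow> inv x \<otimes> y \<in> A"
    and V_rank: "V x mod 3 = 0" and E_rank: "E x mod 3 = 1" and F_rank: "F x mod 3 = 2"
begin

abbreviation "C \<equiv> carrier G"

text \<open>Cosets are incident when they intersect. A coset of \<open>B\<close> always meets a
  coset of \<open>A\<close>, so the order contains all pairs of a vertex and a face, which also
  makes it transitive.\<close>

definition P :: "nat ranked_poset" where
  "P = \<lparr>elems = V ` C \<union> E ` C \<union> F ` C,
        ord = Id_on (V ` C \<union> E ` C \<union> F ` C) \<union> {(V x, E x) |x. x \<in> C} \<union> {(E x, F x) |x. x \<in> C} \<union>
              V ` C \<times> F ` C,
        rk = (\<lambda>x. x mod 3)\<rparr>"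

lemma elems_P: "elems P = V ` C \<union> E ` C \<union> F ` C"
  by (simp add: P_def)

lemma rk_P [simp]: "rk P x = x mod 3"
  by (simp add: P_def)

lemma rank_distinct [simp]: "V x \<noteq> E y" "V x \<noteq> F y" "E x \<noteq> F y" "E x \<noteq> V y" "F x \<noteq> V y" "F x \<noteq> E y"
  using V_rank E_rank F_rank by (metis zero_neq_one zero_neq_numeral one_eq_numeral_iff num.distinct(1))+

lemma vertices_P: "vertices P = V ` C" and edges_P: "edges P = E ` C" and faces_P: "faces P = F ` C"
  by (auto simp: vertices_def edges_def faces_def P_def V_rank E_rank F_rank
      simp flip: mod_eq_0_iff_dvd)

lemma V_mult [simp]: "x \<in> C \<Longrightarrow> \<beta> \<in> B \<Longrightarrow> V (x \<otimes> \<beta>) = V x"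
  by (subst eq_commute, subst V_eq) (auto simp: m_assoc[symmetric])

lemma F_mult [simp]: "x \<in> C \<Longrightarrow> \<alpha> \<in> A \<Longrightarrow> F (x \<otimes> \<alpha>) = F x"
  by (subst eq_commute, subst F_eq) (auto simp: m_assoc[symmetric])

lemma E_mult_t [simp]: "x \<in> C \<Longrightarrow> E (x \<otimes> t) = E x"
  by (subst eq_commute, subst E_eq) (auto simp: m_assoc[symmetric])

lemma V_eqE:
  assumes "V x = V y" "x \<in> C" "y \<in> C" obtains \<beta> where "\<beta> \<in> B" "y = x \<otimes> \<beta>"
proof
  show "inv x \<otimes> y \<in> B" using V_eq assms by blast
  show "y = x \<otimes> (inv x \<otimes> y)" using assms by (simp add: m_assoc[symmetric])
qed

lemma F_eqE:
  assumes "F x = F y" "x \<in> C" "y \<in> C" obtains \<alpha> where "\<alpha> \<in> A" "y = x \<otimes> \<alpha>"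
proof
  show "inv x \<otimes> y \<in> A" using F_eq assms by blast
  show "y = x \<otimes> (inv x \<otimes> y)" using assms by (simp add: m_assoc[symmetric])
qed

lemma E_eqD:
  assumes "E x = E y" "x \<in> C" "y \<in> C" shows "y = x \<or> y = x \<otimes> t"
proof -
  have "inv x \<otimes> y = \<one> \<or> inv x \<otimes> y = t" using E_eq assms by blast
  moreover have "y = x \<otimes> (inv x \<otimes> y)" using assms by (simp add: m_assoc[symmetric])
  ultimately show ?thesis using assms by (metis r_one)
qed

lemma V_mult_t: "x \<in> C \<Longrightarrow> V (x \<otimes> t) = V (x \<otimes> a)"
  by (simp add: m_assoc[symmetric])

lemma F_mult_t: "x \<in> C \<Longrightarrow> F (x \<otimes> t) = F (x \<otimes> inv b)"
  by (simp only: t_eq) (simp add: m_assoc[symmetric])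

lemma E_mult_b: "x \<in> C \<Longrightarrow> E (x \<otimes> b) = E (x \<otimes> inv a)"
  using E_mult_t[of "x \<otimes> b"] by (simp add: m_assoc b_a_b)

lemma V_mult_t_neq: "x \<in> C \<Longrightarrow> V (x \<otimes> t) \<noteq> V x"
  using V_eq[of x "x \<otimes> t"] t_notin_B by (simp add: m_assoc[symmetric])

lemma F_mult_t_neq: "x \<in> C \<Longrightarrow> F (x \<otimes> t) \<noteq> F x"
  using F_eq[of x "x \<otimes> t"] t_notin_A by (simp add: m_assoc[symmetric])

lemma E_mult_b_neq: "x \<in> C \<Longrightarrow> E (x \<otimes> b) \<noteq> E x"
proof
  assume x: "x \<in> C" and "E (x \<otimes> b) = E x"
  then consider "x \<otimes> b = x" | "x \<otimes> b = x \<otimes> t" using E_eqD[of x "x \<otimes> b"] by auto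
  then show False
  proof cases
    case 1
    then show ?thesis using x b_nontrivial by simp
  next
    case 2
    then have "b = t" using x by simp
    then show ?thesis using t_notin_B b_in_B by simp
  qed
qed

lemma incident_sym: "incident P x y \<longleftrightarrow> incident P y x"
  by (auto simp: incident_def)

text \<open>The edge coset of \<open>x\<close> is the pair of \<open>x\<close> and
  \<open>x \<otimes> t\<close>, and its ends are the vertex cosets of these two elements.\<close>

lemma incident_E_V:
  assumes "x \<in> C" "y \<in> C"
  shows "incident P (E x) (V y) \<longleftrightarrow> V y \<in> {V x, V (x \<otimes> t)}"
proof -
  have "incident P (E x) (V y) \<longleftrightarrow> (\<exists>z\<in>C. V z = V y \<and> E z = E x)"
    using assms by (auto simp: incident_def P_def)
  also have "\<dots> \<longleftrightarrow> V y \<in> {V x, V (x \<otimes> t)}"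
  proof
    assume "\<exists>z\<in>C. V z = V y \<and> E z = E x"
    then obtain z where "z \<in> C" "V z = V y" "E x = E z" by auto
    then show "V y \<in> {V x, V (x \<otimes> t)}" using assms by (metis E_eqD insertCI)
  next
    assume "V y \<in> {V x, V (x \<otimes> t)}"
    then show "\<exists>z\<in>C. V z = V y \<and> E z = E x"
      using assms E_mult_t by (metis a_closed b_closed insertE m_closed singletonD)
  qed
  finally show ?thesis .
qed

lemma incident_E_F:
  assumes "x \<in> C" "y \<in> C"
  shows "incident P (E x) (F y) \<longleftrightarrow> F y \<in> {F x, F (x \<otimes> t)}"
proof -
  have "incident P (E x) (F y) \<longleftrightarrow> (\<exists>z\<in>C. F z = F y \<and> E z = E x)"
    using assms by (auto simp: incident_def P_def)
  also have "\<dots> \<longleftrightarrow> F y \<in> {F x, F (x \<otimes> t)}"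
  proof
    assume "\<exists>z\<in>C. F z = F y \<and> E z = E x"
    then obtain z where "z \<in> C" "F z = F y" "E x = E z" by auto
    then show "F y \<in> {F x, F (x \<otimes> t)}" using assms by (metis E_eqD insertCI)
  next
    assume "F y \<in> {F x, F (x \<otimes> t)}"
    then show "\<exists>z\<in>C. F z = F y \<and> E z = E x"
      using assms E_mult_t by (metis a_closed b_closed insertE m_closed singletonD)
  qed
  finally show ?thesis .
qed

lemma incident_V_F: "x \<in> C \<Longrightarrow> y \<in> C \<Longrightarrow> incident P (V x) (F y)"
  by (auto simp: incident_def P_def)

lemma not_incident_same:
  "x \<in> C \<Longrightarrow> y \<in> C \<Longrightarrow> \<not> incident P (V x) (V y)" "x \<in> C \<Longrightarrow> y \<in> C \<Longrightarrow> \<not> incident P (E x) (E y)"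
  "x \<in> C \<Longrightarrow> y \<in> C \<Longrightarrow> \<not> incident P (F x) (F y)"
  by (auto simp: incident_def P_def)

text \<open>Writing \<open>inv x \<otimes> y\<close> as an element of \<open>B\<close> times one of
  \<open>A\<close> yields a point common to the two cosets. Statements about a vertex and a face
  thereby reduce to \<open>V z\<close> and \<open>F z\<close> with a single
  \<open>z\<close>.\<close>

lemma V_F_common:
  assumes "x \<in> C" "y \<in> C"
  obtains z where "z \<in> C" "V z = V x" "F z = F y"
proof -
  obtain \<beta> \<alpha> where *: "\<beta> \<in> B" "\<alpha> \<in> A" "inv x \<otimes> y = \<beta> \<otimes> \<alpha>"
    using factorization'[of "inv x \<otimes> y"] assms by auto
  have "y = x \<otimes> (inv x \<otimes> y)" using assms by (simp add: m_assoc[symmetric])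
  then have "y = (x \<otimes> \<beta>) \<otimes> \<alpha>" using * assms by (simp add: m_assoc)
  then have "F (x \<otimes> \<beta>) = F y" using * assms by simp
  then show ?thesis using that[of "x \<otimes> \<beta>"] * assms by simp
qed

lemma E_at_V:
  assumes "x \<in> C" shows "{e \<in> edges P. incident P e (V x)} = (\<lambda>\<beta>. E (x \<otimes> \<beta>)) ` B"
proof (intro equalityI subsetI)
  fix e assume "e \<in> {e \<in> edges P. incident P e (V x)}"
  then obtain y where y: "y \<in> C" "e = E y" "V x \<in> {V y, V (y \<otimes> t)}"
    using incident_E_V assms by (auto simp: edges_P)
  then obtain z where z: "z \<in> C" "E z = e" "V x = V z"
    by (metis E_mult_t a_closed b_closed insertE m_closed singletonD)
  then obtain \<beta> where "\<beta> \<in> B" "z = x \<otimes> \<beta>" using V_eqE assms by metis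
  then show "e \<in> (\<lambda>\<beta>. E (x \<otimes> \<beta>)) ` B" using z by auto
next
  fix e assume "e \<in> (\<lambda>\<beta>. E (x \<otimes> \<beta>)) ` B"
  then show "e \<in> {e \<in> edges P. incident P e (V x)}"
    using assms by (auto simp: edges_P incident_E_V)
qed

lemma E_at_F:
  assumes "x \<in> C" shows "{e \<in> edges P. incident P e (F x)} = (\<lambda>\<alpha>. E (x \<otimes> \<alpha>)) ` A"
proof (intro equalityI subsetI)
  fix e assume "e \<in> {e \<in> edges P. incident P e (F x)}"
  then obtain y where y: "y \<in> C" "e = E y" "F x \<in> {F y, F (y \<otimes> t)}"
    using incident_E_F assms by (auto simp: edges_P)
  then obtain z where z: "z \<in> C" "E z = e" "F x = F z"
    by (metis E_mult_t a_closed b_closed insertE m_closed singletonD)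
  then obtain \<beta> where "\<beta> \<in> A" "z = x \<otimes> \<beta>" using F_eqE assms by metis
  then show "e \<in> (\<lambda>\<beta>. E (x \<otimes> \<beta>)) ` A" using z by auto
next
  fix e assume "e \<in> (\<lambda>\<beta>. E (x \<otimes> \<beta>)) ` A"
  then show "e \<in> {e \<in> edges P. incident P e (F x)}"
    using assms by (auto simp: edges_P incident_E_F)
qed

text \<open>Different elements of \<open>B\<close> give different edges: two representatives of one
  edge differ by \<open>t\<close>, and right multiplication by \<open>t\<close> leaves the vertex
  coset.\<close>

lemma card_E_at_V: assumes "x \<in> C" shows "card {e \<in> edges P. incident P e (V x)} = ord b"
proof -
  have "inj_on (\<lambda>\<beta>. E (x \<otimes> \<beta>)) B"
  proof (rule inj_onI)
    fix \<beta> \<gamma> assume *: "\<beta> \<in> B" "\<gamma> \<in> B" "E (x \<otimes> \<beta>) = E (x \<otimes> \<gamma>)"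
    then consider "x \<otimes> \<gamma> = x \<otimes> \<beta>" | "x \<otimes> \<gamma> = x \<otimes> \<beta> \<otimes> t"
      using assms E_eqD[of "x \<otimes> \<beta>" "x \<otimes> \<gamma>"] by auto
    then show "\<beta> = \<gamma>"
    proof cases
      case 2
      have "V (x \<otimes> \<beta> \<otimes> t) = V (x \<otimes> \<beta>)" using 2 * assms by (metis V_mult)
      then show ?thesis using V_mult_t_neq[of "x \<otimes> \<beta>"] * assms by simp
    qed (use * assms in simp)
  qed
  then show ?thesis using E_at_V assms by (simp add: card_image generate_pow_card)
qed

lemma card_E_at_F: assumes "x \<in> C" shows "card {e \<in> edges P. incident P e (F x)} = ord a"
proof -
  have "inj_on (\<lambda>\<beta>. E (x \<otimes> \<beta>)) A"
  proof (rule inj_onI)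
    fix \<beta> \<gamma> assume *: "\<beta> \<in> A" "\<gamma> \<in> A" "E (x \<otimes> \<beta>) = E (x \<otimes> \<gamma>)"
    then consider "x \<otimes> \<gamma> = x \<otimes> \<beta>" | "x \<otimes> \<gamma> = x \<otimes> \<beta> \<otimes> t"
      using assms E_eqD[of "x \<otimes> \<beta>" "x \<otimes> \<gamma>"] by auto
    then show "\<beta> = \<gamma>"
    proof cases
      case 2
      have "F (x \<otimes> \<beta> \<otimes> t) = F (x \<otimes> \<beta>)" using 2 * assms by (metis F_mult)
      then show ?thesis using F_mult_t_neq[of "x \<otimes> \<beta>"] * assms by simp
    qed (use * assms in simp)
  qed
  then show ?thesis using E_at_F assms by (simp add: card_image generate_pow_card)
qed

text \<open>A common edge is represented both by some \<open>x \<otimes> \<alpha>\<close> and by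
  some \<open>x \<otimes> \<beta>\<close>, which agree up to \<open>t\<close>. Either
  \<open>\<beta> = \<alpha>\<close> or
  \<open>\<beta> \<otimes> inv b = \<alpha> \<otimes> a\<close>, and in both cases the common value
  lies in \<open>A\<close> and \<open>B\<close>, hence is trivial.\<close>

lemma E_at_V_F:
  assumes x: "x \<in> C"
  shows "{e \<in> edges P. incident P e (V x) \<and> incident P e (F x)} = {E x, E (x \<otimes> b)}"
proof (intro equalityI subsetI)
  fix e assume "e \<in> {e \<in> edges P. incident P e (V x) \<and> incident P e (F x)}"
  then obtain \<alpha> \<beta> where *: "\<alpha> \<in> A" "\<beta> \<in> B" "e = E (x \<otimes> \<alpha>)" "e = E (x \<otimes> \<beta>)"
    using E_at_V[OF x] E_at_F[OF x] by blast
  then consider "x \<otimes> \<beta> = x \<otimes> \<alpha>" | "x \<otimes> \<beta> = x \<otimes> \<alpha> \<otimes> t"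
    using x E_eqD[of "x \<otimes> \<alpha>" "x \<otimes> \<beta>"] by auto
  then show "e \<in> {E x, E (x \<otimes> b)}"
  proof cases
    case 1
    then have "\<beta> = \<alpha>" using * x by simp
    then have "\<beta> = \<one>" using * A_B_unique by blast
    then show ?thesis using * x by simp
  next
    case 2
    then have "\<beta> = \<alpha> \<otimes> (a \<otimes> b)" using * x by (simp add: m_assoc)
    then have "\<beta> \<otimes> inv b = \<alpha> \<otimes> a" using * by (simp add: m_assoc[symmetric] inv_solve_right')
    then have "\<beta> \<otimes> inv b = \<one>" using * A_B_unique by (metis A_group(3) B_group(2,3) a_in_A b_in_B)
    then have "\<beta> = b" using * by (metis B_closed b_closed inv_closed inv_equality inv_inv)
    then show ?thesis using * by simp
  qed
next
  fix e assume "e \<in> {E x, E (x \<otimes> b)}"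
  then show "e \<in> {e \<in> edges P. incident P e (V x) \<and> incident P e (F x)}"
    using x by (auto simp: edges_P incident_E_V incident_E_F m_assoc b_a_b)
qed

lemma partial_order_P: "partial_order_on (elems P) (ranked_poset.ord P)"
  unfolding partial_order_on_def preorder_on_def
proof (intro conjI)
  show "refl_on (elems P) (ranked_poset.ord P)" by (auto simp: P_def refl_on_def)
  show "ranked_poset.ord P \<subseteq> elems P \<times> elems P" by (auto simp: P_def)
  show "trans (ranked_poset.ord P)"
  proof (rule transI)
    fix x y z assume "(x, y) \<in> ranked_poset.ord P" "(y, z) \<in> ranked_poset.ord P"
    then show "(x, z) \<in> ranked_poset.ord P"
      unfolding P_def by (clarsimp simp: Id_on_iff) (elim disjE; clarsimp)
  qed
  show "antisym (ranked_poset.ord P)"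
    unfolding P_def by (rule antisymI) (clarsimp simp: Id_on_iff, elim disjE; clarsimp)
qed

lemma V_at_E: "x \<in> C \<Longrightarrow> {v \<in> vertices P. incident P (E x) v} = {V x, V (x \<otimes> t)}"
  by (auto simp: vertices_P incident_E_V)

lemma F_at_E: "x \<in> C \<Longrightarrow> {f \<in> faces P. incident P (E x) f} = {F x, F (x \<otimes> t)}"
  by (auto simp: faces_P incident_E_F)

section \<open>Connectedness of the incidence graph and of the neighbourhoods\<close>

definition link :: "nat set \<Rightarrow> nat rel" where
  "link S = {(x, y). x \<in> S \<and> y \<in> S \<and> incident P x y}"

lemma link_sym: "(x, y) \<in> (link S)\<^sup>* \<Longrightarrow> (y, x) \<in> (link S)\<^sup>*"
  using sym_rtrancl[of "link S"] by (auto simp: sym_def link_def incident_sym)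

lemma incidence_connectedI:
  assumes "c \<in> S" "\<And>x. x \<in> S \<Longrightarrow> (x, c) \<in> (link S)\<^sup>*"
  shows "incidence_connected P S"
  unfolding incidence_connected_def link_def[symmetric]
  using assms link_sym by (meson empty_iff rtrancl_trans)

lemma link_step: "x \<in> S \<Longrightarrow> y \<in> S \<Longrightarrow> incident P x y \<Longrightarrow> (x, y) \<in> (link S)\<^sup>*"
  by (auto simp: link_def)

text \<open>Every vertex is adjacent to every face, and each edge hangs on one of its
  vertices.\<close>

lemma connected_P: "incidence_connected P (elems P)"
proof (rule incidence_connectedI)
  show "V \<one> \<in> elems P" by (auto simp: elems_P)
  have FV: "(F x, V y) \<in> (link (elems P))\<^sup>*" if "x \<in> C" "y \<in> C" for x y
    using that incident_V_F[of y x] by (intro link_step) (auto simp: elems_P incident_sym)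
  have VV: "(V x, V \<one>) \<in> (link (elems P))\<^sup>*" if "x \<in> C" for x
    using link_sym[OF FV[of \<one> x]] FV[of \<one> \<one>] that by (auto intro: rtrancl_trans)
  fix x assume "x \<in> elems P"
  then consider y where "y \<in> C" "x = V y" | y where "y \<in> C" "x = E y" | y where "y \<in> C" "x = F y"
    by (auto simp: elems_P)
  then show "(x, V \<one>) \<in> (link (elems P))\<^sup>*"
  proof cases
    case (2 y)
    then have "(E y, V y) \<in> (link (elems P))\<^sup>*"
      by (intro link_step) (auto simp: elems_P incident_E_V)
    then show ?thesis using VV 2 by (auto intro: rtrancl_trans)
  qed (use VV FV in auto)
qed

text \<open>Turning about the vertex: the edges of \<open>x \<otimes> b [^] Suc n\<close> and
  \<open>x \<otimes> b [^] n\<close> share the face of \<open>x \<otimes> b [^] n\<close>. Each face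
  is attached to one of these edges through a representative in the vertex coset.\<close>

lemma connected_at_V:
  assumes x: "x \<in> C" shows "incidence_connected P {y. incident P (V x) y}" (is "incidence_connected P ?S")
proof (rule incidence_connectedI)
  show "E x \<in> ?S" using x by (simp add: incident_sym[of "V x"] incident_E_V)
  have E_in: "E (x \<otimes> \<beta>) \<in> ?S" if "\<beta> \<in> B" for \<beta>
    using x that by (simp add: incident_sym[of "V x"] incident_E_V)
  have F_in: "F y \<in> ?S" if "y \<in> C" for y using x that by (simp add: incident_V_F)
  have EF: "(E y, F y) \<in> (link ?S)\<^sup>*" if "\<beta> \<in> B" "y = x \<otimes> \<beta>" for y \<beta>
    using that x E_in F_in by (intro link_step) (auto simp: incident_E_F)
  have pow: "(E (x \<otimes> b [^] n), E x) \<in> (link ?S)\<^sup>*" for n :: nat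
  proof (induction n)
    case (Suc n)
    have n: "b [^] n \<in> B" by simp
    have eq: "x \<otimes> b [^] Suc n = x \<otimes> b [^] n \<otimes> b" using x by (simp add: m_assoc)
    have "incident P (E (x \<otimes> b [^] n \<otimes> b)) (F (x \<otimes> b [^] n))"
      using E_at_V_F[of "x \<otimes> b [^] n"] x by auto
    then have "(E (x \<otimes> b [^] Suc n), F (x \<otimes> b [^] n)) \<in> (link ?S)\<^sup>*"
      unfolding eq using E_in[of "b [^] n \<otimes> b"] n F_in x by (intro link_step) (auto simp: m_assoc)
    also have "(F (x \<otimes> b [^] n), E (x \<otimes> b [^] n)) \<in> (link ?S)\<^sup>*"
      using EF[OF n refl] link_sym by blast
    also note Suc.IH
    finally show ?case .
  qed (use x in simp)
  have EE: "(E (x \<otimes> \<beta>), E x) \<in> (link ?S)\<^sup>*" if "\<beta> \<in> B" for \<beta>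
    using that pow generate_pow_on_finite_carrier[OF fin b_closed] by auto
  fix y assume y: "y \<in> ?S"
  then have "y \<in> elems P" by (simp add: incident_def)
  then consider z where "z \<in> C" "y = E z" | z where "z \<in> C" "y = F z"
    using x y not_incident_same(1)[of x] by (auto simp: elems_P)
  then show "(y, E x) \<in> (link ?S)\<^sup>*"
  proof cases
    case (1 z)
    then have "y \<in> {e \<in> edges P. incident P e (V x)}" using y by (auto simp: edges_P incident_sym)
    then show ?thesis using EE E_at_V[OF x] by auto
  next
    case (2 z)
    then obtain w where w: "w \<in> C" "V x = V w" "F w = F z" using V_F_common[OF x] by metis
    then obtain \<beta> where "\<beta> \<in> B" "w = x \<otimes> \<beta>" using V_eqE x by metis
    then show ?thesis using EE EF link_sym w 2 by (metis rtrancl_trans)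
  qed
qed

text \<open>Turning about the face: the edges of \<open>x \<otimes> a [^] n\<close> and
  \<open>x \<otimes> a [^] Suc n\<close> share the vertex of the latter element.\<close>

lemma connected_at_F:
  assumes x: "x \<in> C" shows "incidence_connected P {y. incident P (F x) y}" (is "incidence_connected P ?S")
proof (rule incidence_connectedI)
  show "E x \<in> ?S" using x by (simp add: incident_sym[of "F x"] incident_E_F)
  have E_in: "E (x \<otimes> \<alpha>) \<in> ?S" if "\<alpha> \<in> A" for \<alpha>
    using x that by (simp add: incident_sym[of "F x"] incident_E_F)
  have V_in: "V y \<in> ?S" if "y \<in> C" for y using x that by (simp add: incident_V_F incident_sym[of "F x"])
  have EV: "(E y, V y) \<in> (link ?S)\<^sup>*" if "\<alpha> \<in> A" "y = x \<otimes> \<alpha>" for y \<alpha>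
    using that x E_in V_in by (intro link_step) (auto simp: incident_E_V)
  have pow: "(E (x \<otimes> a [^] n), E x) \<in> (link ?S)\<^sup>*" for n :: nat
  proof (induction n)
    case (Suc n)
    have n: "a [^] n \<in> A" by simp
    have eq: "x \<otimes> a [^] Suc n = x \<otimes> a [^] n \<otimes> a" using x by (simp add: m_assoc)
    have "incident P (E (x \<otimes> a [^] n)) (V (x \<otimes> a [^] n \<otimes> a))"
      using x by (simp add: incident_E_V V_mult_t)
    then have "(E (x \<otimes> a [^] n), V (x \<otimes> a [^] Suc n)) \<in> (link ?S)\<^sup>*"
      unfolding eq using E_in[OF n] V_in x by (intro link_step) auto
    then have "(V (x \<otimes> a [^] Suc n), E (x \<otimes> a [^] n)) \<in> (link ?S)\<^sup>*" by (rule link_sym)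
    moreover have "(E (x \<otimes> a [^] Suc n), V (x \<otimes> a [^] Suc n)) \<in> (link ?S)\<^sup>*"
      using EV[of "a [^] Suc n"] n by simp
    ultimately show ?case using Suc.IH by (meson rtrancl_trans)
  qed (use x in simp)
  have EE: "(E (x \<otimes> \<alpha>), E x) \<in> (link ?S)\<^sup>*" if "\<alpha> \<in> A" for \<alpha>
    using that pow generate_pow_on_finite_carrier[OF fin a_closed] by auto
  fix y assume y: "y \<in> ?S"
  then have "y \<in> elems P" by (simp add: incident_def)
  then consider z where "z \<in> C" "y = E z" | z where "z \<in> C" "y = V z"
    using x y not_incident_same(3)[of x] by (auto simp: elems_P)
  then show "(y, E x) \<in> (link ?S)\<^sup>*"
  proof cases
    case (1 z)
    then have "y \<in> {e \<in> edges P. incident P e (F x)}" using y by (auto simp: edges_P incident_sym)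
    then show ?thesis using EE E_at_F[OF x] by auto
  next
    case (2 z)
    then obtain w where w: "w \<in> C" "V z = V w" "F x = F w" using V_F_common[of z x] x by metis
    then obtain \<alpha> where "\<alpha> \<in> A" "w = x \<otimes> \<alpha>" using F_eqE x by metis
    then show ?thesis using EE EV link_sym w 2 by (metis rtrancl_trans)
  qed
qed

lemma polyhedron_P: "polyhedron P"
proof -
  have "card {e \<in> edges P. incident P e v \<and> incident P e f} = 2"
    if vf: "v \<in> vertices P" "f \<in> faces P" for v f
  proof -
    obtain x y where "x \<in> C" "y \<in> C" "v = V x" "f = F y" using vf by (auto simp: vertices_P faces_P)
    then obtain z where "z \<in> C" "v = V z" "f = F z" using V_F_common by metis
    then show ?thesis using E_at_V_F[of z] E_mult_b_neq[of z] by simp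
  qed
  moreover have "card {v \<in> vertices P. incident P e v} = 2" "card {f \<in> faces P. incident P e f} = 2"
    if e: "e \<in> edges P" for e
  proof -
    obtain x where x: "x \<in> C" "e = E x" using e by (auto simp: edges_P)
    show "card {v \<in> vertices P. incident P e v} = 2" "card {f \<in> faces P. incident P e f} = 2"
      using V_at_E[OF x(1)] F_at_E[OF x(1)] x V_mult_t_neq[OF x(1), symmetric] F_mult_t_neq[OF x(1), symmetric]
      by simp_all
  qed
  moreover have "\<forall>x y. (x, y) \<in> ranked_poset.ord P \<and> x \<noteq> y \<longrightarrow> rk P x < rk P y"
    by (auto simp: P_def V_rank E_rank F_rank)
  moreover have "\<forall>x\<in>elems P. rk P x \<in> {0, 1, 2}" by auto
  moreover have "\<forall>x \<in> vertices P \<union> faces P. incidence_connected P {y. incident P x y}"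
    using connected_at_V connected_at_F by (auto simp: vertices_P faces_P)
  ultimately show ?thesis
    unfolding polyhedron_def using partial_order_P connected_P by blast
qed

section \<open>Type and the two classes of flags\<close>

lemma has_type_P: "has_type P (ord a) (ord b)"
  unfolding has_type_def using card_E_at_V card_E_at_F by (auto simp: vertices_P faces_P)

text \<open>\<open>Dfl x\<close> is the flag adjacent to \<open>Cfl x\<close> by exchanging the edge.\<close>

definition Cfl :: "'a \<Rightarrow> nat flag" where "Cfl x = (V x, E x, F x)"
definition Dfl :: "'a \<Rightarrow> nat flag" where "Dfl x = (V x, E (x \<otimes> b), F x)"

text \<open>Once a flag's vertex and face are written with the same \<open>z\<close>, only the two
  common edges from \<open>E_at_V_F\<close> are left for its edge.\<close>

lemma flags_P: "flags P = Cfl ` C \<union> Dfl ` C"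
proof (intro equalityI subsetI)
  fix \<Phi> assume "\<Phi> \<in> flags P"
  then obtain v e f where \<Phi>: "\<Phi> = (v, e, f)" "v \<in> vertices P" "f \<in> faces P"
      "e \<in> edges P" "incident P e v" "incident P e f"
    using incident_sym by (auto simp: flags_def)
  then obtain x y where "x \<in> C" "y \<in> C" "v = V x" "f = F y" by (auto simp: vertices_P faces_P)
  then obtain z where z: "z \<in> C" "v = V z" "f = F z" using V_F_common by metis
  then have "e \<in> {E z, E (z \<otimes> b)}" using E_at_V_F[of z] \<Phi> by auto
  then show "\<Phi> \<in> Cfl ` C \<union> Dfl ` C" using z \<Phi>(1) by (auto simp: Cfl_def Dfl_def)
next
  fix \<Phi> assume "\<Phi> \<in> Cfl ` C \<union> Dfl ` C"
  then obtain x e where "x \<in> C" "\<Phi> = (V x, e, F x)" "e \<in> {E x, E (x \<otimes> b)}"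
    by (auto simp: Cfl_def Dfl_def)
  then show "\<Phi> \<in> flags P"
    using E_at_V_F[of x] incident_V_F[of x x] incident_sym
    by (auto simp: flags_def vertices_P faces_P)
qed

text \<open>With the two lemmas that follow, any two components of \<open>Cfl x\<close> determine
  \<open>x\<close>, so that distinct flags of this class differ in at least two places.\<close>

lemma V_F_inj:
  assumes "V x = V y" "F x = F y" "x \<in> C" "y \<in> C" shows "x = y"
proof -
  obtain \<beta> where \<beta>: "\<beta> \<in> B" "y = x \<otimes> \<beta>" using V_eqE assms by metis
  obtain \<alpha> where \<alpha>: "\<alpha> \<in> A" "y = x \<otimes> \<alpha>" using F_eqE assms by metis
  have "\<alpha> = \<beta>" using \<alpha> \<beta> assms by (metis A_closed B_closed Units_eq Units_l_cancel)
  then show ?thesis using A_B_unique \<alpha> \<beta> assms by (metis r_one)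
qed

lemma V_E_inj:
  assumes "V x = V y" "E x = E y" "x \<in> C" "y \<in> C" shows "x = y"
  using E_eqD[of x y] V_mult_t_neq[of x] assms by auto

lemma F_E_inj:
  assumes "F x = F y" "E x = E y" "x \<in> C" "y \<in> C" shows "x = y"
  using E_eqD[of x y] F_mult_t_neq[of x] assms by auto

lemma Cfl_Dfl_disjoint: "Cfl ` C \<inter> Dfl ` C = {}"
  using V_F_inj E_mult_b_neq by (fastforce simp: Cfl_def Dfl_def)

lemma card_flags_P: "card (flags P) = 2 * order G"
proof -
  have "inj_on Cfl C" "inj_on Dfl C"
    using V_F_inj by (auto simp: inj_on_def Cfl_def Dfl_def)
  then show ?thesis
    using Cfl_Dfl_disjoint fin by (simp add: flags_P card_Un_disjoint card_image order_def)
qed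

lemma adjacent_flagsD:
  assumes "adjacent_flags P i (v, e, f) (v', e', f')"
  shows "(v, e, f) \<noteq> (v', e', f')" and "v = v' \<and> e = e' \<or> v = v' \<and> f = f' \<or> e = e' \<and> f = f'"
proof -
  have eq: "{j \<in> {0, 1, 2}. flag_elem (v, e, f) j \<noteq> flag_elem (v', e', f') j} = {i}"
    using assms by (simp add: adjacent_flags_def)
  show "(v, e, f) \<noteq> (v', e', f')" using eq by (auto simp del: flag_elem.simps)
  have "flag_elem (v, e, f) j \<noteq> flag_elem (v', e', f') j \<longleftrightarrow> j = i" if "j \<in> {0, 1, 2}" for j
    using eq that by blast
  from this[of 0] this[of 1] this[of 2]
  show "v = v' \<and> e = e' \<or> v = v' \<and> f = f' \<or> e = e' \<and> f = f'" by auto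
qed

lemma not_adjacent_Cfl: "x \<in> C \<Longrightarrow> y \<in> C \<Longrightarrow> \<not> adjacent_flags P i (Cfl x) (Cfl y)"
  unfolding Cfl_def using adjacent_flagsD V_F_inj V_E_inj F_E_inj by blast

lemma not_adjacent_Dfl:
  assumes "x \<in> C" "y \<in> C" shows "\<not> adjacent_flags P i (Dfl x) (Dfl y)"
proof
  assume adj: "adjacent_flags P i (Dfl x) (Dfl y)"
  consider "V x = V y" "E (x \<otimes> b) = E (y \<otimes> b)" | "V x = V y" "F x = F y"
    | "F x = F y" "E (x \<otimes> b) = E (y \<otimes> b)"
    using adjacent_flagsD(2) adj unfolding Dfl_def by blast
  then have "x = y"
  proof cases
    case 1
    then have "x \<otimes> b = y \<otimes> b" using assms by (intro V_E_inj) auto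
    then show ?thesis using assms by simp
  next
    case 2
    then show ?thesis using V_F_inj assms by blast
  next
    case 3
    \<comment> \<open>\<open>x \<otimes> b\<close> lies outside the face coset of \<open>x\<close>,
      but the other element \<open>x \<otimes> inv a\<close> of its edge coset lies inside, which
      makes \<open>F_E_inj\<close> applicable.\<close>
    then have "E (x \<otimes> inv a) = E (y \<otimes> inv a)" using assms by (simp add: E_mult_b)
    then have "x \<otimes> inv a = y \<otimes> inv a" using assms 3 by (intro F_E_inj) auto
    then show ?thesis using assms by simp
  qed
  then show False using adjacent_flagsD(1) adj unfolding Dfl_def by blast
qed

text \<open>Neither of the two disjoint classes contains a pair of adjacent flags, so adjacency
  switches the class.\<close>

lemma flag_adj_class:
  assumes "\<Phi> \<in> flags P" "i \<in> {0, 1, 2}"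
  shows "\<Phi> \<in> Cfl ` C \<longleftrightarrow> flag_adj P i \<Phi> \<in> Dfl ` C"
proof -
  have adj: "adjacent_flags P i \<Phi> (flag_adj P i \<Phi>)"
    unfolding flag_adj_def using flag_adj_ex1[OF polyhedron_P assms] by (rule theI')
  then have "flag_adj P i \<Phi> \<in> flags P" by (simp add: adjacent_flags_def)
  moreover have "\<not> (\<Phi> \<in> Cfl ` C \<and> flag_adj P i \<Phi> \<in> Cfl ` C)"
    using adj not_adjacent_Cfl by auto
  moreover have "\<not> (\<Phi> \<in> Dfl ` C \<and> flag_adj P i \<Phi> \<in> Dfl ` C)"
    using adj not_adjacent_Dfl by auto
  ultimately show ?thesis using assms(1) Cfl_Dfl_disjoint unfolding flags_P by blast
qed

section \<open>Action of the group by left multiplication\<close>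

lemma left_mult_inv: "g \<in> C \<Longrightarrow> x \<in> C \<Longrightarrow> y \<in> C \<Longrightarrow> inv (g \<otimes> x) \<otimes> (g \<otimes> y) = inv x \<otimes> y"
proof -
  assume *: "g \<in> C" "x \<in> C" "y \<in> C"
  then have "inv g \<otimes> (g \<otimes> y) = y" by (simp add: m_assoc[symmetric])
  then show ?thesis using * by (simp add: inv_mult_group m_assoc)
qed

lemma left_mult_eq:
  assumes "g \<in> C" "x \<in> C" "y \<in> C"
  shows "V (g \<otimes> x) = V (g \<otimes> y) \<longleftrightarrow> V x = V y"
    and "E (g \<otimes> x) = E (g \<otimes> y) \<longleftrightarrow> E x = E y"
    and "F (g \<otimes> x) = F (g \<otimes> y) \<longleftrightarrow> F x = F y"
  using assms left_mult_inv by (simp_all add: V_eq E_eq F_eq)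

text \<open>The action on codes goes through an arbitrarily chosen representative;
  \<open>left_mult_eq\<close> shows that the choice does not matter.\<close>

definition act :: "'a \<Rightarrow> nat \<Rightarrow> nat" where
  "act g n = (if n \<in> V ` C then V (g \<otimes> inv_into C V n)
              else if n \<in> E ` C then E (g \<otimes> inv_into C E n) else F (g \<otimes> inv_into C F n))"

lemma act:
  assumes "g \<in> C" "x \<in> C"
  shows "act g (V x) = V (g \<otimes> x)" "act g (E x) = E (g \<otimes> x)" "act g (F x) = F (g \<otimes> x)"
proof -
  have *: "inv_into C f (f x) \<in> C" "f (inv_into C f (f x)) = f x" for f :: "'a \<Rightarrow> nat"
    using assms by (auto intro: inv_into_into f_inv_into_f)
  show "act g (V x) = V (g \<otimes> x)"
    using assms * left_mult_eq by (auto simp: act_def)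
  have "E x \<notin> V ` C" "F x \<notin> V ` C" "F x \<notin> E ` C" by auto
  then show "act g (E x) = E (g \<otimes> x)" "act g (F x) = F (g \<otimes> x)"
    using assms * left_mult_eq by (auto simp: act_def)
qed

lemma act_automorphism:
  assumes g: "g \<in> C" shows "act g \<in> automorphisms P"
proof -
  have inverse: "act g (act (inv g) n) = n" "act (inv g) (act g n) = n" if "n \<in> elems P" for n
    using that g by (auto simp: elems_P act m_assoc[symmetric])
  have closed: "act h ` elems P \<subseteq> elems P" if "h \<in> C" for h
    using that by (auto simp: elems_P act)
  have bij: "bij_betw (act g) (elems P) (elems P)"
    by (rule bij_betw_byWitness[where f' = "act (inv g)"]) (use inverse closed g in auto)
  have rank: "rk P (act g n) = rk P n" if "n \<in> elems P" for n
    using that g by (auto simp: elems_P act V_rank E_rank F_rank)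
  have EV: "incident P (act g (E x)) (act g (V y)) = incident P (E x) (V y)"
    and EF: "incident P (act g (E x)) (act g (F y)) = incident P (E x) (F y)"
    if "x \<in> C" "y \<in> C" for x y
    using g that left_mult_eq[OF g that(2) that(1)] left_mult_eq[OF g that(2), of "x \<otimes> t"]
    by (simp_all add: act incident_E_V incident_E_F m_assoc)
  have "incident P (act g m) (act g n) \<longleftrightarrow> incident P m n" if mn: "m \<in> elems P" "n \<in> elems P" for m n
  proof -
    obtain x where x: "x \<in> C" "m = V x \<or> m = E x \<or> m = F x" using mn by (auto simp: elems_P)
    obtain y where y: "y \<in> C" "n = V y \<or> n = E y \<or> n = F y" using mn by (auto simp: elems_P)
    have VE: "incident P (act g (V x)) (act g (E y)) = incident P (V x) (E y)"
      and FE: "incident P (act g (F x)) (act g (E y)) = incident P (F x) (E y)"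
      and VF: "incident P (act g (V x)) (act g (F y))" "incident P (V x) (F y)"
      and FV: "incident P (act g (F x)) (act g (V y))" "incident P (F x) (V y)"
      using EV[OF y(1) x(1)] EF[OF y(1) x(1)] incident_V_F g x(1) y(1) incident_sym by (auto simp: act)
    have same: "\<not> incident P (act g (V x)) (act g (V y))" "\<not> incident P (V x) (V y)"
      "\<not> incident P (act g (E x)) (act g (E y))" "\<not> incident P (E x) (E y)"
      "\<not> incident P (act g (F x)) (act g (F y))" "\<not> incident P (F x) (F y)"
      using not_incident_same g x(1) y(1) by (simp_all add: act)
    show ?thesis using x(2) y(2) EV[OF x(1) y(1)] EF[OF x(1) y(1)] VE FE VF FV same by metis
  qed
  then show ?thesis using bij rank by (simp add: automorphisms_def)
qed

lemma flag_map_act: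
  assumes "g \<in> C" "x \<in> C"
  shows "flag_map (act g) (Cfl x) = Cfl (g \<otimes> x)" "flag_map (act g) (Dfl x) = Dfl (g \<otimes> x)"
  using assms by (simp_all add: flag_map_def Cfl_def Dfl_def act m_assoc)

lemma transitive_classes: "aut_transitive_on P (Cfl ` C)" "aut_transitive_on P (Dfl ` C)"
proof -
  have "\<exists>g\<in>automorphisms P. flag_map g (Cfl x) = Cfl y \<and> flag_map g (Dfl x) = Dfl y"
    if "x \<in> C" "y \<in> C" for x y
    using that act_automorphism[of "y \<otimes> inv x"] flag_map_act[of "y \<otimes> inv x" x]
    by (intro bexI[of _ "act (y \<otimes> inv x)"]) (auto simp: m_assoc)
  then show "aut_transitive_on P (Cfl ` C)" "aut_transitive_on P (Dfl ` C)"
    unfolding aut_transitive_on_def by blast+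
qed

section \<open>Automorphisms that exchange the two classes\<close>

context
  fixes \<phi> assumes \<phi>: "\<phi> \<in> automorphisms P"
begin

lemma \<phi>_incident: "incident P x y \<Longrightarrow> incident P (\<phi> x) (\<phi> y)"
  using \<phi> by (auto simp: automorphisms_def incident_def)

lemma \<phi>_inj: "x \<in> elems P \<Longrightarrow> y \<in> elems P \<Longrightarrow> \<phi> x = \<phi> y \<Longrightarrow> x = y"
  using \<phi> by (auto simp: automorphisms_def bij_betw_def inj_on_def)

lemma \<phi>_rank:
  "v \<in> vertices P \<Longrightarrow> \<phi> v \<in> vertices P" "e \<in> edges P \<Longrightarrow> \<phi> e \<in> edges P" "f \<in> faces P \<Longrightarrow> \<phi> f \<in> faces P"
  using \<phi> by (auto simp: automorphisms_def bij_betw_def vertices_def edges_def faces_def)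

text \<open>Each element of the new flag is the only one other than a known element that is incident
  with two known elements, so its image is forced.\<close>

lemma flag_map_step_b:
  assumes g: "g \<in> C" and h: "h \<in> C" and gh: "flag_map \<phi> (Cfl g) = Dfl h"
  shows "flag_map \<phi> (Cfl (g \<otimes> b)) = Dfl (h \<otimes> inv b)"
proof -
  have im: "\<phi> (V g) = V h" "\<phi> (E g) = E (h \<otimes> b)" "\<phi> (F g) = F h"
    using gh by (auto simp: flag_map_def Cfl_def Dfl_def)
  have "E (g \<otimes> b) \<in> edges P" "incident P (E (g \<otimes> b)) (V g)" "incident P (E (g \<otimes> b)) (F g)"
    using E_at_V_F[OF g] by auto
  then have "\<phi> (E (g \<otimes> b)) \<in> {e \<in> edges P. incident P e (V h) \<and> incident P e (F h)}"
    using \<phi>_rank \<phi>_incident im by (metis (mono_tags, lifting) mem_Collect_eq)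
  moreover have "\<phi> (E (g \<otimes> b)) \<noteq> E (h \<otimes> b)"
    using \<phi>_inj[of "E (g \<otimes> b)" "E g"] E_mult_b_neq[OF g] g im by (auto simp: elems_P)
  ultimately have Eb: "\<phi> (E (g \<otimes> b)) = E h" using E_at_V_F[OF h] by auto
  have F_neq: "F (g \<otimes> b) \<noteq> F g"
    using F_mult_t_neq[of "g \<otimes> b"] F_mult_t[of "g \<otimes> b"] g by (simp add: m_assoc)
  have "F (g \<otimes> b) \<in> faces P" "incident P (E (g \<otimes> b)) (F (g \<otimes> b))"
    using g by (auto simp: faces_P incident_E_F)
  then have "\<phi> (F (g \<otimes> b)) \<in> {f \<in> faces P. incident P (E h) f}"
    using \<phi>_rank \<phi>_incident Eb by (metis (mono_tags, lifting) mem_Collect_eq)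
  moreover have "\<phi> (F (g \<otimes> b)) \<noteq> F h"
    using \<phi>_inj[of "F (g \<otimes> b)" "F g"] F_neq g im by (auto simp: elems_P)
  ultimately have "\<phi> (F (g \<otimes> b)) = F (h \<otimes> inv b)" using F_at_E[OF h] F_mult_t[OF h] by auto
  then show ?thesis using g h im Eb by (simp add: flag_map_def Cfl_def Dfl_def m_assoc)
qed

lemma flag_map_step_a:
  assumes g: "g \<in> C" and h: "h \<in> C" and gh: "flag_map \<phi> (Cfl g) = Dfl h"
  shows "flag_map \<phi> (Cfl (g \<otimes> a)) = Dfl (h \<otimes> inv a)"
proof -
  have im: "\<phi> (V g) = V h" "\<phi> (E g) = E (h \<otimes> b)" "\<phi> (F g) = F h"
    using gh by (auto simp: flag_map_def Cfl_def Dfl_def)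
  have V_neq: "V (g \<otimes> a) \<noteq> V g" using V_mult_t_neq[OF g] V_mult_t[OF g] by simp
  have "V (g \<otimes> a) \<in> vertices P" "incident P (E g) (V (g \<otimes> a))"
    using g V_mult_t[OF g] by (auto simp: vertices_P incident_E_V)
  then have "\<phi> (V (g \<otimes> a)) \<in> {v \<in> vertices P. incident P (E (h \<otimes> b)) v}"
    using \<phi>_rank \<phi>_incident im by (metis (mono_tags, lifting) mem_Collect_eq)
  moreover have "\<phi> (V (g \<otimes> a)) \<noteq> V h"
    using \<phi>_inj[of "V (g \<otimes> a)" "V g"] V_neq g im by (auto simp: elems_P)
  ultimately have Va: "\<phi> (V (g \<otimes> a)) = V (h \<otimes> inv a)"
    using V_at_E[of "h \<otimes> b"] h by (auto simp: m_assoc b_a_b)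
  \<comment> \<open>The image of \<open>E g\<close> is thus one of the two edges common to
    \<open>V (h \<otimes> inv a)\<close> and \<open>F (h \<otimes> inv a)\<close>; the image of
    \<open>E (g \<otimes> a)\<close> must be the other one.\<close>
  have ha: "E (h \<otimes> inv a) = E (h \<otimes> b)"
    using E_mult_b[OF h] by simp
  have E_neq: "E (g \<otimes> a) \<noteq> E g"
    using E_mult_b_neq[of "g \<otimes> a"] g E_mult_t[OF g] by (simp add: m_assoc)
  have edge: "E (g \<otimes> a) \<in> edges P"
    and "incident P (E (g \<otimes> a)) (V (g \<otimes> a))" "incident P (E (g \<otimes> a)) (F g)"
    using E_at_V_F[of "g \<otimes> a"] g by auto
  then have "incident P (\<phi> (E (g \<otimes> a))) (V (h \<otimes> inv a))" "incident P (\<phi> (E (g \<otimes> a))) (F h)"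
    using \<phi>_incident Va im(3) by metis+
  then have "\<phi> (E (g \<otimes> a)) \<in> {e \<in> edges P. incident P e (V (h \<otimes> inv a)) \<and> incident P e (F (h \<otimes> inv a))}"
    using \<phi>_rank(2)[OF edge] h by simp
  moreover have "\<phi> (E (g \<otimes> a)) \<noteq> E (h \<otimes> inv a)"
    using \<phi>_inj[of "E (g \<otimes> a)" "E g"] E_neq g im ha by (auto simp: elems_P)
  ultimately have "\<phi> (E (g \<otimes> a)) = E (h \<otimes> inv a \<otimes> b)" using E_at_V_F[of "h \<otimes> inv a"] h by auto
  then show ?thesis using g h im Va by (simp add: flag_map_def Cfl_def Dfl_def)
qed

text \<open>By finiteness \<open>inv c\<close> is some power \<open>c [^] n\<close> with natural
  \<open>n\<close>, so a backward step is a sequence of \<open>n\<close> forward steps.\<close>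

lemma flag_map_step_inv:
  assumes c: "c \<in> C"
    and step: "\<And>g h. g \<in> C \<Longrightarrow> h \<in> C \<Longrightarrow> flag_map \<phi> (Cfl g) = Dfl h \<Longrightarrow>
                 flag_map \<phi> (Cfl (g \<otimes> c)) = Dfl (h \<otimes> inv c)"
    and gh: "g \<in> C" "h \<in> C" "flag_map \<phi> (Cfl g) = Dfl h"
  shows "flag_map \<phi> (Cfl (g \<otimes> inv c)) = Dfl (h \<otimes> c)"
proof -
  have pow: "flag_map \<phi> (Cfl (g \<otimes> c [^] n)) = Dfl (h \<otimes> inv c [^] n)" for n :: nat
  proof (induction n)
    case (Suc n)
    then show ?case using step[of "g \<otimes> c [^] n" "h \<otimes> inv c [^] n"] gh c by (simp add: m_assoc)
  qed (use gh in simp)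
  obtain n where n: "inv c = c [^] (n::nat)"
    using generate_pow_on_finite_carrier[OF fin c] generate.inv[of c "{c}" G] by blast
  then have "inv c [^] n = c" using c by (metis inv_inv nat_pow_inv)
  then show ?thesis using pow[of n] n by simp
qed

text \<open>While a word in \<open>a\<close> and \<open>b\<close> moves \<open>Cfl g\<close>, the
  same word in their inverses moves the image flag. The subgroup of pairs records both words at once
  and does not presuppose that inverting the generators is a well-defined map.\<close>

lemma flag_map_generate:
  assumes "xy \<in> generate (G \<times>\<times> G) {(a, inv a), (b, inv b)}"
    "g \<in> C" "h \<in> C" "flag_map \<phi> (Cfl g) = Dfl h"
  shows "flag_map \<phi> (Cfl (g \<otimes> fst xy)) = Dfl (h \<otimes> snd xy)"
  using assms
proof (induction arbitrary: g h rule: generate.induct)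
  case one
  then show ?case by simp
next
  case (incl xy)
  then have "xy = (a, inv a) \<or> xy = (b, inv b)" by simp
  then show ?case
    using flag_map_step_a[OF incl.prems] flag_map_step_b[OF incl.prems] by (elim disjE) simp_all
next
  case (inv xy)
  have pow_a: "flag_map \<phi> (Cfl (g \<otimes> inv a)) = Dfl (h \<otimes> a)"
    by (rule flag_map_step_inv[OF a_closed flag_map_step_a inv.prems])
  have pow_b: "flag_map \<phi> (Cfl (g \<otimes> inv b)) = Dfl (h \<otimes> b)"
    by (rule flag_map_step_inv[OF b_closed flag_map_step_b inv.prems])
  have "inv\<^bsub>G \<times>\<times> G\<^esub> (a, inv a) = (inv a, a)" "inv\<^bsub>G \<times>\<times> G\<^esub> (b, inv b) = (inv b, b)"
    by (simp_all add: is_group)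
  then show ?case using pow_a pow_b inv.hyps by auto
next
  case (eng xy zw)
  interpret GG: group "G \<times>\<times> G" by (intro DirProd_group is_group)
  have "{(a, inv a), (b, inv b)} \<subseteq> carrier (G \<times>\<times> G)" by simp
  then have "xy \<in> carrier (G \<times>\<times> G)" "zw \<in> carrier (G \<times>\<times> G)"
    using eng.hyps GG.generate_in_carrier by blast+
  then have closed: "fst xy \<in> C" "snd xy \<in> C" "fst zw \<in> C" "snd zw \<in> C" by auto
  have "flag_map \<phi> (Cfl (g \<otimes> fst xy \<otimes> fst zw)) = Dfl (h \<otimes> snd xy \<otimes> snd zw)"
    using eng.IH(2)[OF _ _ eng.IH(1)[OF eng.prems]] eng.prems closed by simp
  then show ?case
    using eng.prems closed by (simp add: mult_DirProd' m_assoc)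
qed

end

text \<open>The pair comes from a relation that fails for the inverse generators. An automorphism
  taking \<open>Cfl \<one>\<close> to \<open>Dfl \<one>\<close> would also have to take it to
  \<open>Dfl h\<close>.\<close>

lemma not_transitive:
  assumes "(\<one>, h) \<in> generate (G \<times>\<times> G) {(a, inv a), (b, inv b)}" "h \<in> C" "h \<noteq> \<one>"
  shows "\<not> aut_transitive_on P (flags P)"
proof
  assume "aut_transitive_on P (flags P)"
  moreover have "Cfl \<one> \<in> flags P" "Dfl \<one> \<in> flags P" by (auto simp: flags_P)
  ultimately obtain \<phi> where \<phi>: "\<phi> \<in> automorphisms P" "flag_map \<phi> (Cfl \<one>) = Dfl \<one>"
    unfolding aut_transitive_on_def by blast
  have "flag_map \<phi> (Cfl \<one>) = Dfl h"
    using flag_map_generate[OF \<phi>(1) assms(1) _ _ \<phi>(2)] assms(2) by simp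
  then have "Dfl \<one> = Dfl h" using \<phi> by simp
  then show False using V_F_inj[of \<one> h] assms by (auto simp: Dfl_def)
qed

lemma tight_chiral_P:
  assumes "(\<one>, h) \<in> generate (G \<times>\<times> G) {(a, inv a), (b, inv b)}" "h \<in> C" "h \<noteq> \<one>"
    and "order G = ord a * ord b"
  shows "tight_chiral_polyhedron P (ord a) (ord b)"
proof -
  have "Cfl ` C \<union> Dfl ` C = flags P \<and> Cfl ` C \<inter> Dfl ` C = {} \<and>
      (\<forall>\<Phi>\<in>flags P. \<forall>i\<in>{0, 1, 2}. \<Phi> \<in> Cfl ` C \<longleftrightarrow> flag_adj P i \<Phi> \<in> Dfl ` C) \<and>
      aut_transitive_on P (Cfl ` C) \<and> aut_transitive_on P (Dfl ` C)"
    using flags_P Cfl_Dfl_disjoint flag_adj_class transitive_classes by metis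
  then have "chiral P"
    unfolding chiral_def using not_transitive[OF assms(1-3)] by blast
  then show ?thesis
    using polyhedron_P has_type_P card_flags_P assms(4) by (simp add: tight_chiral_polyhedron_def)
qed

end

section \<open>From group data to polyhedra\<close>

definition tight_chiral_group :: "('a, 'b) monoid_scheme \<Rightarrow> 'a \<Rightarrow> 'a \<Rightarrow> nat \<Rightarrow> nat \<Rightarrow> bool" where
  "tight_chiral_group G a b p q \<longleftrightarrow>
     group G \<and> finite (carrier G) \<and> order G \<le> p * q \<and> a \<in> carrier G \<and> b \<in> carrier G \<and>
     a \<noteq> \<one>\<^bsub>G\<^esub> \<and> b \<noteq> \<one>\<^bsub>G\<^esub> \<and> group.ord G a = p \<and> group.ord G b = q \<and>
     (a \<otimes>\<^bsub>G\<^esub> b) \<otimes>\<^bsub>G\<^esub> (a \<otimes>\<^bsub>G\<^esub> b) = \<one>\<^bsub>G\<^esub> \<and>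
     generate G {a} \<inter> generate G {b} = {\<one>\<^bsub>G\<^esub>} \<and>
     (\<exists>h\<in>carrier G. h \<noteq> \<one>\<^bsub>G\<^esub> \<and> (\<one>\<^bsub>G\<^esub>, h) \<in> generate (G \<times>\<times> G) {(a, inv\<^bsub>G\<^esub> a), (b, inv\<^bsub>G\<^esub> b)})"

text \<open>Sets of group elements are numbered injectively, and \<open>x\<close> gets the number of
  its left coset; this allows a polyhedron on the natural numbers.\<close>

lemma (in group) coset_code:
  assumes fin: "finite (carrier G)" and H: "subgroup H G"
  obtains c :: "'a \<Rightarrow> nat"
  where "\<And>x y. x \<in> carrier G \<Longrightarrow> y \<in> carrier G \<Longrightarrow> c x = c y \<longleftrightarrow> inv x \<otimes> y \<in> H"
proof -
  define S where "S x = {y \<in> carrier G. inv x \<otimes> y \<in> H}" for x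
  obtain f :: "'a set \<Rightarrow> nat" where f: "inj_on f (Pow (carrier G))"
    using finite_imp_inj_to_nat_seg[of "Pow (carrier G)"] fin by auto
  have "f (S x) = f (S y) \<longleftrightarrow> inv x \<otimes> y \<in> H" if xy: "x \<in> carrier G" "y \<in> carrier G" for x y
  proof -
    have "f (S x) = f (S y) \<longleftrightarrow> S x = S y"
      using f by (intro inj_on_eq_iff[of f "Pow (carrier G)"]) (auto simp: S_def)
    also have "\<dots> \<longleftrightarrow> inv x \<otimes> y \<in> H"
    proof
      assume "S x = S y"
      moreover have "y \<in> S y" using xy H by (simp add: S_def subgroup.one_closed)
      ultimately show "inv x \<otimes> y \<in> H" by (auto simp: S_def)
    next
      assume h: "inv x \<otimes> y \<in> H"
      have "inv y \<otimes> z = inv (inv x \<otimes> y) \<otimes> (inv x \<otimes> z)" "inv x \<otimes> z = (inv x \<otimes> y) \<otimes> (inv y \<otimes> z)"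
        if z: "z \<in> carrier G" for z
      proof -
        have "x \<otimes> (inv x \<otimes> z) = z" "y \<otimes> (inv y \<otimes> z) = z"
          using xy z by (simp_all add: m_assoc[symmetric])
        then show "inv y \<otimes> z = inv (inv x \<otimes> y) \<otimes> (inv x \<otimes> z)"
          "inv x \<otimes> z = (inv x \<otimes> y) \<otimes> (inv y \<otimes> z)"
          using xy z by (simp_all add: inv_mult_group m_assoc)
      qed
      then have "inv x \<otimes> z \<in> H \<longleftrightarrow> inv y \<otimes> z \<in> H" if "z \<in> carrier G" for z
        using h H that by (metis subgroup.m_closed subgroup.m_inv_closed)
      then show "S x = S y" by (auto simp: S_def)
    qed
    finally show ?thesis .
  qed
  then show ?thesis using that[of "\<lambda>x. f (S x)"] by blast
qed

lemma tight_chiral_group_polyhedron: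
  assumes "tight_chiral_group G a b p q"
  shows "\<exists>P :: nat ranked_poset. tight_chiral_polyhedron P p q"
proof -
  interpret group G using assms by (simp add: tight_chiral_group_def)
  have *: "finite (carrier G)" "order G \<le> p * q" "a \<in> carrier G" "b \<in> carrier G"
    "a \<noteq> \<one>\<^bsub>G\<^esub>" "b \<noteq> \<one>\<^bsub>G\<^esub>" "ord a = p" "ord b = q"
    "(a \<otimes>\<^bsub>G\<^esub> b) \<otimes>\<^bsub>G\<^esub> (a \<otimes>\<^bsub>G\<^esub> b) = \<one>\<^bsub>G\<^esub>"
    "generate G {a} \<inter> generate G {b} = {\<one>\<^bsub>G\<^esub>}"
    using assms by (auto simp: tight_chiral_group_def)
  obtain h where h: "h \<in> carrier G" "h \<noteq> \<one>\<^bsub>G\<^esub>"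
    "(\<one>\<^bsub>G\<^esub>, h) \<in> generate (G \<times>\<times> G) {(a, inv\<^bsub>G\<^esub> a), (b, inv\<^bsub>G\<^esub> b)}"
    using assms by (auto simp: tight_chiral_group_def)
  have subA: "subgroup (generate G {a}) G" and subB: "subgroup (generate G {b}) G"
    using * by (auto intro!: generate_is_subgroup)
  let ?f = "\<lambda>(x, y). x \<otimes>\<^bsub>G\<^esub> y"
  let ?AB = "generate G {a} \<times> generate G {b}"
  \<comment> \<open>Distinct pairs have distinct products, so there are \<open>p * q\<close>
    products. Under the bound on the order they fill the whole group, which is
    \<open>factorization\<close>.\<close>
  have "inj_on ?f ?AB"
  proof (rule inj_onI, clarify)
    fix x y x' y'
    assume xy: "x \<in> generate G {a}" "y \<in> generate G {b}" "x' \<in> generate G {a}" "y' \<in> generate G {b}"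
      "x \<otimes>\<^bsub>G\<^esub> y = x' \<otimes>\<^bsub>G\<^esub> y'"
    then have c: "x \<in> carrier G" "y \<in> carrier G" "x' \<in> carrier G" "y' \<in> carrier G"
      using subgroup.mem_carrier subA subB by metis+
    have "inv\<^bsub>G\<^esub> x' \<otimes>\<^bsub>G\<^esub> x = y' \<otimes>\<^bsub>G\<^esub> inv\<^bsub>G\<^esub> y"
      using c xy(5) by (metis inv_closed inv_solve_left inv_solve_right m_assoc m_closed)
    moreover have "inv\<^bsub>G\<^esub> x' \<otimes>\<^bsub>G\<^esub> x \<in> generate G {a}" "y' \<otimes>\<^bsub>G\<^esub> inv\<^bsub>G\<^esub> y \<in> generate G {b}"
      using xy subA subB by (auto simp: subgroup.m_inv_closed subgroup.m_closed)
    ultimately have "inv\<^bsub>G\<^esub> x' \<otimes>\<^bsub>G\<^esub> x = \<one>\<^bsub>G\<^esub>" "y' \<otimes>\<^bsub>G\<^esub> inv\<^bsub>G\<^esub> y = \<one>\<^bsub>G\<^esub>" using *(10) by auto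
    then show "x = x' \<and> y = y'" using c by (metis inv_closed inv_equality inv_inv)
  qed
  then have card: "card (?f ` ?AB) = p * q"
    using * by (simp add: card_image card_cartesian_product generate_pow_card)
  have sub: "?f ` ?AB \<subseteq> carrier G"
    using subA subB by (auto simp: subgroup.mem_carrier)
  then have full: "?f ` ?AB = carrier G" and order: "order G = p * q"
    using card_seteq[OF *(1) sub] card *(2) card_mono[OF *(1) sub] by (auto simp: order_def)
  interpret R: rotation_group G a b
  proof
    fix g assume "g \<in> carrier G"
    then have "g \<in> ?f ` ?AB" using full by simp
    then show "\<exists>\<alpha>\<in>generate G {a}. \<exists>\<beta>\<in>generate G {b}. g = \<alpha> \<otimes>\<^bsub>G\<^esub> \<beta>" by auto
  qed (use * in auto)
  have subT: "subgroup {\<one>\<^bsub>G\<^esub>, a \<otimes>\<^bsub>G\<^esub> b} G"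
    by (rule subgroupI) (use *(3,4) R.involution R.inv_t in auto)
  obtain v where v: "\<And>x y. x \<in> carrier G \<Longrightarrow> y \<in> carrier G \<Longrightarrow>
      (v x :: nat) = v y \<longleftrightarrow> inv\<^bsub>G\<^esub> x \<otimes>\<^bsub>G\<^esub> y \<in> generate G {b}"
    using coset_code[OF *(1) subB] by blast
  obtain e where e: "\<And>x y. x \<in> carrier G \<Longrightarrow> y \<in> carrier G \<Longrightarrow>
      (e x :: nat) = e y \<longleftrightarrow> inv\<^bsub>G\<^esub> x \<otimes>\<^bsub>G\<^esub> y \<in> {\<one>\<^bsub>G\<^esub>, a \<otimes>\<^bsub>G\<^esub> b}"
    using coset_code[OF *(1) subT] by blast
  obtain f where f: "\<And>x y. x \<in> carrier G \<Longrightarrow> y \<in> carrier G \<Longrightarrow>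
      (f x :: nat) = f y \<longleftrightarrow> inv\<^bsub>G\<^esub> x \<otimes>\<^bsub>G\<^esub> y \<in> generate G {a}"
    using coset_code[OF *(1) subA] by blast
  interpret coset_polyhedron G a b "\<lambda>x. 3 * v x" "\<lambda>x. 3 * e x + 1" "\<lambda>x. 3 * f x + 2"
    by unfold_locales (simp_all add: v e f, presburger)
  show ?thesis using tight_chiral_P[OF h(3,1,2)] order *(7,8) by auto
qed

section \<open>Duality\<close>

lemma (in group) generate_inv: "x \<in> carrier G \<Longrightarrow> generate G {inv x} = generate G {x}"
proof -
  have "generate G {inv y} \<subseteq> generate G {y}" if "y \<in> carrier G" for y
    using that by (intro generate_subgroup_incl) (auto intro: generate.inv generate_is_subgroup)
  from this[of x] this[of "inv x"] show "x \<in> carrier G \<Longrightarrow> ?thesis" by auto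
qed

text \<open>\<open>inv b \<otimes> inv a\<close> is the inverse of \<open>a \<otimes> b\<close>,
  hence again squares to one. The new pairs are the inverses of the old ones, so the failing
  relation is inherited.\<close>

lemma tight_chiral_group_dual:
  assumes "tight_chiral_group G a b p q"
  shows "tight_chiral_group G (inv\<^bsub>G\<^esub> b) (inv\<^bsub>G\<^esub> a) q p"
proof -
  interpret group G using assms by (simp add: tight_chiral_group_def)
  have ab: "a \<in> carrier G" "b \<in> carrier G" "(a \<otimes>\<^bsub>G\<^esub> b) \<otimes>\<^bsub>G\<^esub> (a \<otimes>\<^bsub>G\<^esub> b) = \<one>\<^bsub>G\<^esub>"
    using assms by (auto simp: tight_chiral_group_def)
  interpret GG: group "G \<times>\<times> G" by (intro DirProd_group is_group)
  let ?K = "{(a, inv\<^bsub>G\<^esub> a), (b, inv\<^bsub>G\<^esub> b)}" and ?L = "{(inv\<^bsub>G\<^esub> b, b), (inv\<^bsub>G\<^esub> a, a)}"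
  have L: "subgroup (generate (G \<times>\<times> G) ?L) (G \<times>\<times> G)"
    using ab by (intro GG.generate_is_subgroup) auto
  have "inv\<^bsub>G \<times>\<times> G\<^esub> (inv\<^bsub>G\<^esub> b, b) \<in> generate (G \<times>\<times> G) ?L" "inv\<^bsub>G \<times>\<times> G\<^esub> (inv\<^bsub>G\<^esub> a, a) \<in> generate (G \<times>\<times> G) ?L"
    by (auto intro: generate.inv)
  then have "?K \<subseteq> generate (G \<times>\<times> G) ?L" using ab by simp
  then have KL: "generate (G \<times>\<times> G) ?K \<subseteq> generate (G \<times>\<times> G) ?L"
    using GG.generate_subgroup_incl[OF _ L] by blast
  have inv2: "(inv\<^bsub>G\<^esub> b \<otimes>\<^bsub>G\<^esub> inv\<^bsub>G\<^esub> a) \<otimes>\<^bsub>G\<^esub> (inv\<^bsub>G\<^esub> b \<otimes>\<^bsub>G\<^esub> inv\<^bsub>G\<^esub> a) = \<one>\<^bsub>G\<^esub>"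
    using ab by (metis inv_mult_group inv_one m_closed)
  have ord: "ord (inv\<^bsub>G\<^esub> x) = ord x" if "x \<in> carrier G" for x
    using that by (simp add: generate_pow_card generate_inv)
  show ?thesis
    using assms ab inv2 KL unfolding tight_chiral_group_def
    by (auto simp: ord generate_inv mult.commute Int_commute)
qed

section \<open>The group covering all examples\<close>

text \<open>Triangular numbers, extended to negative arguments. Up to sign they count the factors
  $z$ that appear when a power of $y b^{-1}$ is brought into the form $b^i y^k z^l$.\<close>

definition tri :: "int \<Rightarrow> int" where "tri i = i * (i + 1) div 2"

lemma two_tri: "2 * tri i = i * (i + 1)"
  unfolding tri_def by simp

lemma tri_0 [simp]: "tri 0 = 0" and tri_1 [simp]: "tri 1 = 1"
  by (simp_all add: tri_def)

lemma tri_add: "tri (i + j) = tri i + tri j + i * j"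
proof -
  have "2 * tri (i + j) = 2 * (tri i + tri j + i * j)"
    unfolding distrib_left two_tri by (simp add: algebra_simps)
  then show ?thesis by simp
qed

lemma tri_minus: "tri (- i) = tri i - i"
proof -
  have "2 * tri (- i) = 2 * (tri i - i)"
    unfolding right_diff_distrib two_tri by (simp add: algebra_simps)
  then show ?thesis by simp
qed

lemma tri_diff: "tri (i - j) = tri i + tri j - j - i * j"
  using tri_add[of i "- j"] tri_minus[of j] by simp

section \<open>The infinite cover group\<close>

definition sg :: "int \<Rightarrow> int" where "sg v = (if even v then 1 else - 1)"

type_synonym quint = "int \<times> int \<times> int \<times> int \<times> int"

text \<open>The first three coordinates of \<open>(i, k, l, u, v)\<close> stand for the element $b^i y^k z^l$ of the
  Heisenberg group. An odd \<open>u\<close> acts on it by $b \mapsto y b^{-1}$ and $y \mapsto b y b^{-1}$, which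
  sends \<open>(i, k, l)\<close> to \<open>(- i, i + k, - l - tri i - k)\<close>.\<close>

fun quint_mult :: "quint \<Rightarrow> quint \<Rightarrow> quint" where
  "quint_mult (i, k, l, u, v) (i', k', l', u', v') =
     (if even u then (i + i', k + k', l + l' + k * i', u + sg v * u', v + v')
      else (i - i', k + i' + k', l - l' - tri i' - k' - k * i', u + sg v * u', v - v'))"

text \<open>Both generators have \<open>i + u + v\<close> even. This restriction saves a factor of
  two in the second case of \<open>order_GM\<close>.\<close>

definition cover_group :: "quint monoid" ("\<Gamma>") where
  "\<Gamma> = \<lparr>carrier = {(i, k, l, u, v). even (i + u + v)}, mult = quint_mult, one = (0, 0, 0, 0, 0)\<rparr>"

lemma carrier_cover [simp]: "(i, k, l, u, v) \<in> carrier \<Gamma> \<longleftrightarrow> even (i + u + v)"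
  and mult_cover [simp]: "x \<otimes>\<^bsub>\<Gamma>\<^esub> y = quint_mult x y"
  and one_cover [simp]: "\<one>\<^bsub>\<Gamma>\<^esub> = (0, 0, 0, 0, 0)"
  by (simp_all add: cover_group_def)

lemma quint_mult_assoc: "quint_mult (quint_mult x y) z = quint_mult x (quint_mult y z)"
proof -
  obtain i k l u v where x: "x = (i, k, l, u, v)" by (cases x)
  obtain i' k' l' u' v' where y: "y = (i', k', l', u', v')" by (cases y)
  obtain i'' k'' l'' u'' v'' where z: "z = (i'', k'', l'', u'', v'')" by (cases z)
  show ?thesis unfolding x y z
    by (cases "even u"; cases "even u'"; cases "even v"; cases "even v'")
      (simp_all add: sg_def tri_add tri_diff algebra_simps)
qed

lemma quint_mult_closed: "x \<in> carrier \<Gamma> \<Longrightarrow> y \<in> carrier \<Gamma> \<Longrightarrow> quint_mult x y \<in> carrier \<Gamma>"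
  by (cases x; cases y) (auto simp: sg_def)

lemma quint_inverse:
  assumes "x \<in> carrier \<Gamma>" shows "\<exists>y\<in>carrier \<Gamma>. quint_mult y x = (0, 0, 0, 0, 0)"
proof -
  obtain i k l u v where x: "x = (i, k, l, u, v)" by (cases x)
  show ?thesis
  proof (cases "even u")
    case True
    then show ?thesis using assms unfolding x
      by (intro bexI[of _ "(- i, - k, - l + k * i, - sg v * u, - v)"]) (auto simp: sg_def)
  next
    case False
    then show ?thesis using assms two_tri[of i] unfolding x
      by (intro bexI[of _ "(i, - i - k, l - k * i - tri (- i) + k, - sg v * u, v)"])
        (auto simp: sg_def tri_minus algebra_simps)
  qed
qed

interpretation \<Gamma>: group \<Gamma>
proof (rule groupI)
  fix x assume "x \<in> carrier \<Gamma>"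
  then show "\<exists>y\<in>carrier \<Gamma>. y \<otimes>\<^bsub>\<Gamma>\<^esub> x = \<one>\<^bsub>\<Gamma>\<^esub>" using quint_inverse by simp
  show "\<one>\<^bsub>\<Gamma>\<^esub> \<otimes>\<^bsub>\<Gamma>\<^esub> x = x" by (cases x) (simp add: sg_def)
qed (use quint_mult_closed quint_mult_assoc in simp_all)

text \<open>Chosen so that the product of \<open>gen_a\<close> and \<open>gen_b\<close> is
  \<open>(0, 0, 0, 1, - 1)\<close>, the involution that exchanges $b$ and $y b^{-1}$.\<close>

definition gen_a :: quint where "gen_a = (1, - 1, 0, 1, 0)"
definition gen_b :: quint where "gen_b = (1, 0, 0, 0, 1)"

lemma gen_closed [simp]: "gen_a \<in> carrier \<Gamma>" "gen_b \<in> carrier \<Gamma>"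
  by (simp_all add: gen_a_def gen_b_def)

lemma gen_involution: "quint_mult (quint_mult gen_a gen_b) (quint_mult gen_a gen_b) = (0, 0, 0, 0, 0)"
  by (simp add: gen_a_def gen_b_def sg_def)

lemma inv_gen_a: "inv\<^bsub>\<Gamma>\<^esub> gen_a = (1, 0, 0, - 1, 0)"
  by (rule \<Gamma>.inv_equality) (simp_all add: gen_a_def sg_def)

lemma inv_gen_b: "inv\<^bsub>\<Gamma>\<^esub> gen_b = (- 1, 0, 0, 0, - 1)"
  by (rule \<Gamma>.inv_equality) (simp_all add: gen_b_def sg_def)

text \<open>The square of \<open>gen_a\<close> has even \<open>u\<close> and vanishing first and
  last coordinates, so its powers simply add up in each coordinate.\<close>

lemma gen_a_pow: "gen_a [^]\<^bsub>\<Gamma>\<^esub> (2 * s) = (0, - int s, int s, 2 * int s, 0)"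
proof (induction s)
  case (Suc s)
  have "gen_a [^]\<^bsub>\<Gamma>\<^esub> (2 * Suc s) = gen_a [^]\<^bsub>\<Gamma>\<^esub> (2 * s) \<otimes>\<^bsub>\<Gamma>\<^esub> gen_a \<otimes>\<^bsub>\<Gamma>\<^esub> gen_a" by simp
  then show ?case unfolding Suc.IH by (simp add: gen_a_def sg_def)
qed simp

lemma gen_a_pow_odd: "gen_a [^]\<^bsub>\<Gamma>\<^esub> (Suc (2 * s)) = (1, - int s - 1, 0, 2 * int s + 1, 0)"
proof -
  have "gen_a [^]\<^bsub>\<Gamma>\<^esub> (Suc (2 * s)) = gen_a [^]\<^bsub>\<Gamma>\<^esub> (2 * s) \<otimes>\<^bsub>\<Gamma>\<^esub> gen_a" by simp
  then show ?thesis unfolding gen_a_pow by (simp add: gen_a_def sg_def)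
qed

lemma gen_b_pow: "gen_b [^]\<^bsub>\<Gamma>\<^esub> (r::nat) = (int r, 0, 0, 0, int r)"
proof (induction r)
  case (Suc r)
  have "gen_b [^]\<^bsub>\<Gamma>\<^esub> (Suc r) = gen_b [^]\<^bsub>\<Gamma>\<^esub> r \<otimes>\<^bsub>\<Gamma>\<^esub> gen_b" by simp
  then show ?case unfolding Suc.IH by (simp add: gen_b_def sg_def)
qed simp

section \<open>Congruences on the cover group\<close>

lemma (in group) inv_mult_eq_one:
  "x \<in> carrier G \<Longrightarrow> y \<in> carrier G \<Longrightarrow> inv y \<otimes> x = \<one> \<longleftrightarrow> x = y"
  by (metis inv_equality inv_inv inv_closed l_inv)

text \<open>The quotient imposes $b^{q_1} = 1$, $y^h = 1$ and $z = b^Q y^{-j}$, so that $z^n = 1$, and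
  reduces \<open>u\<close> modulo \<open>p2\<close> and \<open>v\<close> modulo \<open>q2\<close>.\<close>

locale cover_quotient =
  fixes h q1 p2 q2 n Q j :: int
  assumes h_q1: "h dvd q1" and n_h: "n dvd h" and q1_eq: "q1 = n * Q" and n_Q: "n dvd Q"
    and n_j: "n dvd j" and h_nj: "h dvd n * j" and h_Q: "h dvd Q - 2 * j"
    and n_parity: "odd n \<or> 2 * n dvd Q"
    and p2_even: "even p2" and q2_parity: "even q2 \<or> p2 = 2"
    and pos: "h > 0" "q1 > 0" "p2 > 0" "q2 > 0" "n > 0"
begin

text \<open>Replacing $z$ by $b^Q y^{-j}$ turns $b^i y^k z^l$ into $b^{i + lQ} y^{k - lj}$; the
  exponents are then compared modulo \<open>q1\<close> and \<open>h\<close>.\<close>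

fun sim :: "quint \<Rightarrow> quint \<Rightarrow> bool" where
  "sim (i, k, l, u, v) (i', k', l', u', v') \<longleftrightarrow>
     q1 dvd (i - i') + (l - l') * Q \<and> h dvd (k - k') - (l - l') * j \<and> p2 dvd u - u' \<and> q2 dvd v - v'"

lemma n_q1: "n dvd q1" using q1_eq by simp

text \<open>This and the next lemma express $z^n = 1$ in the two exponents that replace $z$.\<close>

lemma n_mult_Q: "n dvd e \<Longrightarrow> q1 dvd e * Q"
  by (simp add: q1_eq mult_dvd_mono)

lemma n_mult_j: "n dvd e \<Longrightarrow> h dvd e * j"
  using h_nj by (meson dvd_trans dvd_refl mult_dvd_mono)

text \<open>Quantities that enter the exponent of $z$ matter only modulo \<open>n\<close>. For
  \<open>tri\<close>, twice the difference is \<open>(i - i') * (i + i' + 1)\<close>: an odd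
  \<open>n\<close> permits division by 2, and for even \<open>n\<close> the hypothesis
  \<open>n_parity\<close> supplies the congruence of \<open>i\<close> and \<open>i'\<close> modulo
  \<open>2 * n\<close>.\<close>

lemma sim_n:
  assumes "q1 dvd (i - i') + (l - l') * Q" "h dvd (k - k') - (l - l') * j"
  shows "n dvd i - i'" "n dvd k - k'" "n dvd tri i - tri i'"
proof -
  have "n dvd (i - i') + (l - l') * Q" using assms(1) n_q1 by (rule dvd_trans[rotated])
  then show i: "n dvd i - i'" using n_Q by (simp add: dvd_add_left_iff)
  have "n dvd (k - k') - (l - l') * j" using assms(2) n_h by (rule dvd_trans[rotated])
  then show "n dvd k - k'" using n_j by (metis diff_add_cancel dvd_add dvd_mult)
  have two: "2 * (tri i - tri i') = (i - i') * (i + i' + 1)"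
    unfolding right_diff_distrib two_tri by (simp add: algebra_simps)
  show "n dvd tri i - tri i'"
  proof (cases "odd n")
    case True
    then have "coprime n 2" by simp
    then show ?thesis using two i by (metis coprime_dvd_mult_right_iff dvd_mult2)
  next
    case False
    then have Q: "2 * n dvd Q" using n_parity by simp
    then have "2 * n dvd q1" by (simp add: q1_eq)
    then have "2 * n dvd (i - i') + (l - l') * Q" using assms(1) by (rule dvd_trans)
    then have "2 * n dvd i - i'" using Q by (simp add: dvd_add_left_iff)
    then have "2 * n dvd 2 * (tri i - tri i')" unfolding two by simp
    then show ?thesis unfolding dvd_mult_cancel_left by simp
  qed
qed

lemma sim_refl: "sim x x"
  by (cases x) simp

lemma sim_sym: "sim x y \<Longrightarrow> sim y x"
proof -
  assume *: "sim x y"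
  obtain i k l u v where x: "x = (i, k, l, u, v)" by (cases x)
  obtain i' k' l' u' v' where y: "y = (i', k', l', u', v')" by (cases y)
  have eq: "(i' - i) + (l' - l) * Q = - ((i - i') + (l - l') * Q)"
    "(k' - k) - (l' - l) * j = - ((k - k') - (l - l') * j)" by (simp_all add: algebra_simps)
  show ?thesis using * dvd_diff_commute[of p2 u' u] dvd_diff_commute[of q2 v' v]
    unfolding x y sim.simps eq dvd_minus_iff by blast
qed

lemma sim_trans: "sim x y \<Longrightarrow> sim y z \<Longrightarrow> sim x z"
proof -
  assume *: "sim x y" "sim y z"
  obtain i k l u v where x: "x = (i, k, l, u, v)" by (cases x)
  obtain i' k' l' u' v' where y: "y = (i', k', l', u', v')" by (cases y)
  obtain i'' k'' l'' u'' v'' where z: "z = (i'', k'', l'', u'', v'')" by (cases z)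
  have eq: "(i - i'') + (l - l'') * Q = ((i - i') + (l - l') * Q) + ((i' - i'') + (l' - l'') * Q)"
    "(k - k'') - (l - l'') * j = ((k - k') - (l - l') * j) + ((k' - k'') - (l' - l'') * j)"
    "u - u'' = (u - u') + (u' - u'')" "v - v'' = (v - v') + (v' - v'')"
    by (simp_all add: algebra_simps)
  have "q1 dvd (i - i') + (l - l') * Q" "h dvd (k - k') - (l - l') * j" "p2 dvd u - u'" "q2 dvd v - v'"
    "q1 dvd (i' - i'') + (l' - l'') * Q" "h dvd (k' - k'') - (l' - l'') * j" "p2 dvd u' - u''" "q2 dvd v' - v''"
    using * by (simp_all add: x y z)
  from this(1-4)[THEN dvd_add] this(5-8) show ?thesis unfolding x z sim.simps eq by blast
qed

text \<open>For even \<open>q2\<close> the parity of \<open>v\<close> is determined modulo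
  \<open>q2\<close>; otherwise \<open>p2 = 2\<close> and signs do not matter.\<close>

lemma sg_cong: "q2 dvd v - v' \<Longrightarrow> p2 dvd sg v * u - sg v' * u"
proof (cases "even q2")
  case True
  assume "q2 dvd v - v'"
  then have "even (v - v')" by (rule dvd_trans[OF True])
  then have "sg v = sg v'" by (simp add: sg_def)
  then show ?thesis by simp
next
  case False
  then have "p2 = 2" using q2_parity by simp
  then show ?thesis by (auto simp: sg_def)
qed

lemma parity_u: "p2 dvd u - u' \<Longrightarrow> even u \<longleftrightarrow> even u'"
  using dvd_trans[OF p2_even, of "u - u'"] by simp

text \<open>The only mixed term is \<open>k * I\<close> in the exponent of $z$, and \<open>k\<close>
  is determined modulo \<open>n\<close>.\<close>

lemma sim_mult_right:
  assumes "sim x y" shows "sim (quint_mult x z) (quint_mult y z)"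
proof -
  obtain i k l u v where x: "x = (i, k, l, u, v)" by (cases x)
  obtain i' k' l' u' v' where y: "y = (i', k', l', u', v')" by (cases y)
  obtain I K L U W where z: "z = (I, K, L, U, W)" by (cases z)
  have 1: "q1 dvd (i - i') + (l - l') * Q" and 2: "h dvd (k - k') - (l - l') * j"
    and 3: "p2 dvd u - u'" and 4: "q2 dvd v - v'" using assms by (simp_all add: x y)
  have kQ: "q1 dvd (k - k') * Q * I" and kj: "h dvd (k - k') * j * I"
    using n_mult_Q n_mult_j sim_n(2)[OF 1 2] by (simp_all add: dvd_mult2)
  have u: "p2 dvd (u + sg v * U) - (u' + sg v' * U)"
    using dvd_add[OF 3 sg_cong[OF 4, of U]] by (simp add: algebra_simps)
  show ?thesis
  proof (cases "even u")
    case True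
    then have "even u'" using parity_u[OF 3] by simp
    moreover have "q1 dvd (i + I - (i' + I)) + (l + L + k * I - (l' + L + k' * I)) * Q"
      using dvd_add[OF 1 kQ] by (simp add: algebra_simps)
    moreover have "h dvd (k + K - (k' + K)) - (l + L + k * I - (l' + L + k' * I)) * j"
      using dvd_diff[OF 2 kj] by (simp add: algebra_simps)
    ultimately show ?thesis using True u 4 by (simp add: x y z)
  next
    case False
    then have "odd u'" using parity_u[OF 3] by simp
    moreover have "q1 dvd (i - I - (i' - I)) + (l - L - tri I - K - k * I - (l' - L - tri I - K - k' * I)) * Q"
      using dvd_diff[OF 1 kQ] by (simp add: algebra_simps)
    moreover have "h dvd (k + I + K - (k' + I + K)) - (l - L - tri I - K - k * I - (l' - L - tri I - K - k' * I)) * j"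
      using dvd_add[OF 2 kj] by (simp add: algebra_simps)
    ultimately show ?thesis using False u 4 by (simp add: x y z)
  qed
qed

text \<open>For odd \<open>U\<close> the content is that the exchange of $b$ and $y b^{-1}$ respects
  the imposed relations.\<close>

lemma sim_mult_left:
  assumes "sim y z" shows "sim (quint_mult x y) (quint_mult x z)"
proof -
  obtain i k l u v where y: "y = (i, k, l, u, v)" by (cases y)
  obtain i' k' l' u' v' where z: "z = (i', k', l', u', v')" by (cases z)
  obtain I K L U W where x: "x = (I, K, L, U, W)" by (cases x)
  have 1: "q1 dvd (i - i') + (l - l') * Q" and 2: "h dvd (k - k') - (l - l') * j"
    and 3: "p2 dvd u - u'" and 4: "q2 dvd v - v'" using assms by (simp_all add: y z)
  have iQ: "q1 dvd (i - i') * Q * K" and ij: "h dvd (i - i') * j * K"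
    using n_mult_Q n_mult_j sim_n(1)[OF 1 2] by (simp_all add: dvd_mult2)
  have u: "p2 dvd (U + sg W * u) - (U + sg W * u')"
    using dvd_mult[OF 3, of "sg W"] by (simp add: algebra_simps)
  show ?thesis
  proof (cases "even U")
    case True
    moreover have "q1 dvd (I + i - (I + i')) + (L + l + K * i - (L + l' + K * i')) * Q"
      using dvd_add[OF 1 iQ] by (simp add: algebra_simps)
    moreover have "h dvd (K + k - (K + k')) - (L + l + K * i - (L + l' + K * i')) * j"
      using dvd_diff[OF 2 ij] by (simp add: algebra_simps)
    ultimately show ?thesis using u 4 by (simp add: x y z)
  next
    case False
    have c: "n dvd (tri i - tri i') + (k - k')" using sim_n[OF 1 2] by (rule_tac dvd_add)
    have cQ: "q1 dvd ((tri i - tri i') + (k - k')) * Q" and cj: "h dvd ((tri i - tri i') + (k - k')) * j"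
      using n_mult_Q[OF c] n_mult_j[OF c] .
    have "q1 dvd - ((i - i') + (l - l') * Q) - ((tri i - tri i') + (k - k')) * Q - (i - i') * Q * K"
      by (intro dvd_diff cQ iQ) (simp only: dvd_minus_iff 1)
    then have "q1 dvd (I - i - (I - i')) +
        (L - l - tri i - k - K * i - (L - l' - tri i' - k' - K * i')) * Q"
      by (simp add: algebra_simps)
    \<comment> \<open>The sum of the two given congruences has \<open>Q - j\<close> as the
      coefficient of \<open>l - l'\<close>, whereas \<open>j\<close> is wanted; \<open>h_Q\<close>
      accounts for the difference \<open>Q - 2 * j\<close>.\<close>
    moreover have "h dvd ((i - i') + (l - l') * Q) + ((k - k') - (l - l') * j)
        - (l - l') * (Q - 2 * j) + ((tri i - tri i') + (k - k')) * j + (i - i') * j * K"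
      by (rule dvd_add[OF dvd_add[OF dvd_diff[OF dvd_add[OF dvd_trans[OF h_q1 1] 2]
            dvd_mult[OF h_Q]] cj] ij])
    then have "h dvd (K + i + k - (K + i' + k')) -
        (L - l - tri i - k - K * i - (L - l' - tri i' - k' - K * i')) * j"
      by (simp add: algebra_simps)
    moreover have "q2 dvd (W - v) - (W - v')" using 4 dvd_diff_commute[of q2 v v'] by simp
    ultimately show ?thesis using False u by (simp add: x y z)
  qed
qed

definition M :: "quint set" where "M = {x \<in> carrier \<Gamma>. sim x (0, 0, 0, 0, 0)}"

lemma M_iff: "x \<in> M \<longleftrightarrow> x \<in> carrier \<Gamma> \<and> sim x \<one>\<^bsub>\<Gamma>\<^esub>"
  by (simp add: M_def)

lemma subgroup_M: "subgroup M \<Gamma>"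
proof (rule \<Gamma>.subgroupI)
  show "M \<subseteq> carrier \<Gamma>" by (auto simp: M_iff)
  show "M \<noteq> {}" using \<Gamma>.one_closed sim_refl M_iff by blast
  fix x assume x: "x \<in> M"
  then have "sim (inv\<^bsub>\<Gamma>\<^esub> x \<otimes>\<^bsub>\<Gamma>\<^esub> x) (inv\<^bsub>\<Gamma>\<^esub> x \<otimes>\<^bsub>\<Gamma>\<^esub> \<one>\<^bsub>\<Gamma>\<^esub>)"
    using sim_mult_left unfolding mult_cover by (simp add: M_iff)
  then show "inv\<^bsub>\<Gamma>\<^esub> x \<in> M" using x sim_sym unfolding M_iff
    by (metis \<Gamma>.inv_closed \<Gamma>.l_inv \<Gamma>.r_one)
  fix y assume y: "y \<in> M"
  have "sim (x \<otimes>\<^bsub>\<Gamma>\<^esub> y) (\<one>\<^bsub>\<Gamma>\<^esub> \<otimes>\<^bsub>\<Gamma>\<^esub> y)"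
    using sim_mult_right x unfolding mult_cover by (simp add: M_iff)
  then show "x \<otimes>\<^bsub>\<Gamma>\<^esub> y \<in> M" using x y sim_trans unfolding M_iff
    by (metis \<Gamma>.l_one \<Gamma>.m_closed)
qed

lemma normal_M: "M \<lhd> \<Gamma>"
  unfolding \<Gamma>.normal_inv_iff
proof (intro conjI ballI subgroup_M)
  fix x y assume x: "x \<in> carrier \<Gamma>" and y: "y \<in> M"
  have "sim (x \<otimes>\<^bsub>\<Gamma>\<^esub> y) (x \<otimes>\<^bsub>\<Gamma>\<^esub> \<one>\<^bsub>\<Gamma>\<^esub>)"
    using sim_mult_left y unfolding mult_cover by (simp add: M_iff)
  then have "sim (x \<otimes>\<^bsub>\<Gamma>\<^esub> y \<otimes>\<^bsub>\<Gamma>\<^esub> inv\<^bsub>\<Gamma>\<^esub> x) (x \<otimes>\<^bsub>\<Gamma>\<^esub> \<one>\<^bsub>\<Gamma>\<^esub> \<otimes>\<^bsub>\<Gamma>\<^esub> inv\<^bsub>\<Gamma>\<^esub> x)"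
    using sim_mult_right unfolding mult_cover by blast
  then show "x \<otimes>\<^bsub>\<Gamma>\<^esub> y \<otimes>\<^bsub>\<Gamma>\<^esub> inv\<^bsub>\<Gamma>\<^esub> x \<in> M"
    using x y unfolding M_iff by (metis \<Gamma>.inv_closed \<Gamma>.m_closed \<Gamma>.r_inv \<Gamma>.r_one)
qed

section \<open>The quotient group and its order\<close>

abbreviation "GM \<equiv> \<Gamma> Mod M"

definition proj :: "quint \<Rightarrow> quint set" where "proj x = M #>\<^bsub>\<Gamma>\<^esub> x"

sublocale GM: group GM
  using normal_M by (rule normal.factorgroup_is_group)

sublocale proj: group_hom \<Gamma> GM proj
  using normal.r_coset_hom_Mod[OF normal_M] unfolding proj_def[abs_def]
  by unfold_locales

lemma carrier_GM: "carrier GM = proj ` carrier \<Gamma>"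
  by (auto simp: FactGroup_def RCOSETS_def proj_def)

lemma one_GM: "\<one>\<^bsub>GM\<^esub> = M"
  by (simp add: FactGroup_def)

lemma proj_eq_one: "x \<in> carrier \<Gamma> \<Longrightarrow> proj x = \<one>\<^bsub>GM\<^esub> \<longleftrightarrow> x \<in> M"
  unfolding proj_def one_GM using \<Gamma>.coset_join1 \<Gamma>.coset_join2 subgroup_M by blast

lemma proj_eq:
  assumes "x \<in> carrier \<Gamma>" "y \<in> carrier \<Gamma>"
  shows "proj x = proj y \<longleftrightarrow> sim x y"
proof -
  have "proj (inv\<^bsub>\<Gamma>\<^esub> y \<otimes>\<^bsub>\<Gamma>\<^esub> x) = inv\<^bsub>GM\<^esub> (proj y) \<otimes>\<^bsub>GM\<^esub> proj x"
    using assms by (simp only: proj.hom_mult proj.hom_inv \<Gamma>.inv_closed)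
  then have "proj x = proj y \<longleftrightarrow> proj (inv\<^bsub>\<Gamma>\<^esub> y \<otimes>\<^bsub>\<Gamma>\<^esub> x) = \<one>\<^bsub>GM\<^esub>"
    using GM.inv_mult_eq_one proj.hom_closed assms by simp
  also have "\<dots> \<longleftrightarrow> sim (inv\<^bsub>\<Gamma>\<^esub> y \<otimes>\<^bsub>\<Gamma>\<^esub> x) \<one>\<^bsub>\<Gamma>\<^esub>"
    using assms proj_eq_one[of "inv\<^bsub>\<Gamma>\<^esub> y \<otimes>\<^bsub>\<Gamma>\<^esub> x"] by (simp add: M_iff quint_mult_closed del: one_cover)
  also have "\<dots> \<longleftrightarrow> sim x y"
  proof
    assume "sim (inv\<^bsub>\<Gamma>\<^esub> y \<otimes>\<^bsub>\<Gamma>\<^esub> x) \<one>\<^bsub>\<Gamma>\<^esub>"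
    then have "sim (y \<otimes>\<^bsub>\<Gamma>\<^esub> (inv\<^bsub>\<Gamma>\<^esub> y \<otimes>\<^bsub>\<Gamma>\<^esub> x)) (y \<otimes>\<^bsub>\<Gamma>\<^esub> \<one>\<^bsub>\<Gamma>\<^esub>)"
      using sim_mult_left unfolding mult_cover by blast
    then show "sim x y" using assms
      by (metis \<Gamma>.inv_closed \<Gamma>.l_one \<Gamma>.m_assoc \<Gamma>.r_inv \<Gamma>.r_one)
  next
    assume "sim x y"
    then have "sim (inv\<^bsub>\<Gamma>\<^esub> y \<otimes>\<^bsub>\<Gamma>\<^esub> x) (inv\<^bsub>\<Gamma>\<^esub> y \<otimes>\<^bsub>\<Gamma>\<^esub> y)"
      using sim_mult_left unfolding mult_cover by blast
    then show "sim (inv\<^bsub>\<Gamma>\<^esub> y \<otimes>\<^bsub>\<Gamma>\<^esub> x) \<one>\<^bsub>\<Gamma>\<^esub>" using assms by (metis \<Gamma>.l_inv)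
  qed
  finally show ?thesis .
qed

text \<open>In the second case the parity condition on the carrier of \<open>\<Gamma>\<close> makes the last coordinate
  modulo \<open>2 * c\<close> redundant up to its residue modulo \<open>c\<close>.\<close>

lemma order_GM:
  assumes c: "c = q2 \<or> q2 = 2 * c \<and> odd c \<and> even q1 \<and> even Q" and "c > 0"
  shows "finite (carrier GM)" and "int (order GM) \<le> q1 * h * p2 * c"
proof -
  \<comment> \<open>After elimination of $z$ these residues determine the class, so counting them
    bounds the order.\<close>
  define res where "res = (\<lambda>(i, k, l, u, v). ((i + l * Q) mod q1, (k - l * j) mod h, u mod p2, v mod c))"
  let ?R = "{0..<q1} \<times> {0..<h} \<times> {0..<p2} \<times> {0..<c}"
  have res_R: "res ` carrier \<Gamma> \<subseteq> ?R"
    using pos \<open>c > 0\<close> by (auto simp: res_def)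
  have res_eq: "proj x = proj y" if x: "x \<in> carrier \<Gamma>" and y: "y \<in> carrier \<Gamma>" and xy: "res x = res y" for x y
  proof -
    obtain i k l u v where x': "x = (i, k, l, u, v)" by (cases x)
    obtain i' k' l' u' v' where y': "y = (i', k', l', u', v')" by (cases y)
    have 1: "q1 dvd (i + l * Q) - (i' + l' * Q)" and 2: "h dvd (k - l * j) - (k' - l' * j)"
      and 3: "p2 dvd u - u'" and 4: "c dvd v - v'"
      using xy by (simp_all add: res_def x' y' mod_eq_dvd_iff)
    have "q2 dvd v - v'"
    proof (cases "c = q2")
      case False
      then have c': "q2 = 2 * c" "odd c" "even q1" "even Q" using c by auto
      \<comment> \<open>Since \<open>q1\<close> and \<open>Q\<close> are even, the parity of
        \<open>i\<close> is known, and that of \<open>u\<close> is known from \<open>p2\<close>. The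
        carrier condition then gives the parity of \<open>v\<close>.\<close>
      have "even ((i + l * Q) - (i' + l' * Q))" by (rule dvd_trans[OF c'(3) 1])
      then have "even (i - i')" using c'(4) by simp
      then have "even (v - v')" using x y parity_u[OF 3] by (simp add: x' y')
      then show ?thesis using c'(1,2) 4 by (simp add: divides_mult)
    qed (use 4 in simp)
    moreover have "q1 dvd (i - i') + (l - l') * Q" using 1 by (simp add: algebra_simps)
    moreover have "h dvd (k - k') - (l - l') * j" using 2 by (simp add: algebra_simps)
    ultimately have "sim x y" using 3 by (simp add: x' y')
    then show ?thesis using proj_eq x y by blast
  qed
  have "proj x = proj (inv_into (carrier \<Gamma>) res (res x))" if "x \<in> carrier \<Gamma>" for x
    using that by (intro res_eq) (auto intro: inv_into_into simp: f_inv_into_f)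
  then have "carrier GM \<subseteq> (\<lambda>r. proj (inv_into (carrier \<Gamma>) res r)) ` (res ` carrier \<Gamma>)"
    unfolding carrier_GM by blast
  then have sub: "carrier GM \<subseteq> (\<lambda>r. proj (inv_into (carrier \<Gamma>) res r)) ` ?R"
    using res_R by blast
  show "finite (carrier GM)" using finite_subset[OF sub] by simp
  have "order GM \<le> card ?R"
    unfolding order_def
    by (rule order_trans[OF card_mono[OF finite_imageI sub] card_image_le]) simp_all
  also have "int \<dots> = q1 * h * p2 * c"
    using pos \<open>c > 0\<close> by (simp add: card_cartesian_product)
  finally show "int (order GM) \<le> q1 * h * p2 * c" by simp
qed

section \<open>Powers of the generators in the quotient\<close>

lemma gen_b_pow_M: "gen_b [^]\<^bsub>\<Gamma>\<^esub> (r::nat) \<in> M \<longleftrightarrow> q1 dvd int r \<and> q2 dvd int r"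
  unfolding gen_b_pow by (auto simp: M_def)

text \<open>As \<open>q1 = n * Q\<close>, the first divisibility means \<open>n dvd s\<close>; then
  \<open>s * j\<close> vanishes modulo \<open>h\<close> and the second one becomes
  \<open>h dvd s\<close>.\<close>

lemma gen_a_pow_M: "gen_a [^]\<^bsub>\<Gamma>\<^esub> (2 * s) \<in> M \<longleftrightarrow> h dvd int s \<and> p2 dvd 2 * int s"
proof -
  have "q1 dvd int s * Q \<and> h dvd - int s - int s * j \<longleftrightarrow> h dvd int s"
  proof
    assume *: "q1 dvd int s * Q \<and> h dvd - int s - int s * j"
    moreover have "Q \<noteq> 0" using pos q1_eq by auto
    ultimately have "n dvd int s" by (simp add: q1_eq)
    then have "h dvd int s * j" by (rule n_mult_j)
    then have "h dvd (- int s - int s * j) + int s * j" using * by (intro dvd_add) auto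
    then show "h dvd int s" by simp
  next
    assume h: "h dvd int s"
    then have "n dvd int s" using n_h by (rule dvd_trans[rotated])
    then show "q1 dvd int s * Q \<and> h dvd - int s - int s * j"
      using n_mult_Q h by (auto intro!: dvd_diff)
  qed
  then show ?thesis unfolding gen_a_pow by (auto simp: M_def)
qed

lemma gen_a_pow_odd_M: "gen_a [^]\<^bsub>\<Gamma>\<^esub> (Suc (2 * s)) \<notin> M"
proof
  assume "gen_a [^]\<^bsub>\<Gamma>\<^esub> (Suc (2 * s)) \<in> M"
  then have "p2 dvd 2 * int s + 1" unfolding gen_a_pow_odd by (simp add: M_def)
  then have "even (2 * int s + 1)" by (rule dvd_trans[OF p2_even])
  then show False by simp
qed

text \<open>Powers of \<open>gen_b\<close> have no $y$-part, so \<open>h\<close> divides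
  \<open>t + t * j\<close> for an even exponent \<open>2 * t\<close>. Reducing modulo
  \<open>n\<close> gives \<open>n dvd t\<close>, which removes \<open>t * j\<close>. An odd exponent
  is excluded by the parity of \<open>u\<close>.\<close>

lemma gen_pow_sim:
  assumes "sim (gen_a [^]\<^bsub>\<Gamma>\<^esub> (s::nat)) (gen_b [^]\<^bsub>\<Gamma>\<^esub> (r::nat))"
  shows "gen_a [^]\<^bsub>\<Gamma>\<^esub> s \<in> M"
proof (cases "even s")
  case True
  then obtain t where t: "s = 2 * t" by blast
  have *: "h dvd - int t - int t * j" "p2 dvd 2 * int t"
    using assms unfolding t gen_a_pow gen_b_pow by simp_all
  then have "n dvd - int t - int t * j" using n_h dvd_trans by blast
  then have "n dvd (- int t - int t * j) + int t * j" using n_j by (intro dvd_add) auto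
  then have "n dvd int t" by simp
  then have "h dvd int t * j" by (rule n_mult_j)
  then have "h dvd (- int t - int t * j) + int t * j" using * by (intro dvd_add) auto
  then show ?thesis unfolding t gen_a_pow_M using * by simp
next
  case False
  then obtain t where t: "s = Suc (2 * t)" by (metis oddE Suc_eq_plus1)
  have "p2 dvd 2 * int t + 1"
    using assms unfolding t gen_a_pow_odd gen_b_pow by simp
  then have "even (2 * int t + 1)" by (rule dvd_trans[OF p2_even])
  then show ?thesis by simp
qed

section \<open>Chirality of the quotient\<close>

abbreviation "inverting \<equiv>
  generate (GM \<times>\<times> GM) {(proj gen_a, inv\<^bsub>GM\<^esub> proj gen_a), (proj gen_b, inv\<^bsub>GM\<^esub> proj gen_b)}"

text \<open>Pairs of words are lifted to the cover group, where they can be multiplied in integer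
  coordinates.\<close>

definition inverts :: "quint \<Rightarrow> quint \<Rightarrow> bool" where
  "inverts x y \<longleftrightarrow> x \<in> carrier \<Gamma> \<and> y \<in> carrier \<Gamma> \<and> (proj x, proj y) \<in> inverting"

lemma subgroup_inverting: "subgroup inverting (GM \<times>\<times> GM)"
proof -
  interpret D: group "GM \<times>\<times> GM" by (intro DirProd_group GM.is_group)
  show ?thesis by (intro D.generate_is_subgroup) auto
qed

lemma inverts_mult:
  assumes "inverts x y" "inverts x' y'" shows "inverts (quint_mult x x') (quint_mult y y')"
proof -
  have "(proj x, proj y) \<otimes>\<^bsub>GM \<times>\<times> GM\<^esub> (proj x', proj y') \<in> inverting"
    using assms by (intro subgroup.m_closed[OF subgroup_inverting]) (simp_all add: inverts_def)
  then show ?thesis using assms proj.hom_mult by (simp add: inverts_def quint_mult_closed)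
qed

lemma inverts_inv:
  assumes "inverts x y" shows "inverts (inv\<^bsub>\<Gamma>\<^esub> x) (inv\<^bsub>\<Gamma>\<^esub> y)"
proof -
  have "inv\<^bsub>GM \<times>\<times> GM\<^esub> (proj x, proj y) \<in> inverting"
    using assms by (intro subgroup.m_inv_closed[OF subgroup_inverting]) (simp add: inverts_def)
  then show ?thesis using assms by (simp add: inverts_def GM.is_group)
qed

lemma inverts_one: "inverts (0, 0, 0, 0, 0) (0, 0, 0, 0, 0)"
  using subgroup.one_closed[OF subgroup_inverting] proj.hom_one by (simp add: inverts_def)

lemma inverts_gen: "inverts gen_a (1, 0, 0, - 1, 0)" "inverts gen_b (- 1, 0, 0, 0, - 1)"
  unfolding inv_gen_a[symmetric] inv_gen_b[symmetric] inverts_def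
  by (auto intro: generate.incl)

lemma inverts_gen_inv: "inverts (1, 0, 0, - 1, 0) gen_a" "inverts (- 1, 0, 0, 0, - 1) gen_b"
  using inverts_gen[THEN inverts_inv] by (simp_all add: inv_gen_a[symmetric] inv_gen_b[symmetric])

lemma inverts_a2: "inverts (0, - 1, 1, 2, 0) (0, 1, - 1, - 2, 0)"
  using inverts_mult[OF inverts_gen(1) inverts_gen(1)] by (simp add: gen_a_def sg_def)

lemma inverts_a2_inv: "inverts (0, 1, - 1, - 2, 0) (0, - 1, 1, 2, 0)"
  using inverts_mult[OF inverts_gen_inv(1) inverts_gen_inv(1)] by (simp add: gen_a_def sg_def)

text \<open>The pair of commutators $[a^2, b]$ and $[a^{-2}, b^{-1}]$.\<close>

lemma inverts_commutator: "inverts (0, 0, - 1, 4, 0) (0, 0, - 1, - 4, 0)"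
  using inverts_mult[OF inverts_mult[OF inverts_mult[OF inverts_a2 inverts_gen(2)] inverts_a2_inv]
      inverts_gen_inv(2)] by (simp add: gen_b_def sg_def)

lemma inverts_commutator_pow:
  "inverts (0, 0, - int e, 4 * int e, 0) (0, 0, - int e, - 4 * int e, 0)"
proof (induction e)
  case (Suc e)
  then show ?case using inverts_mult[OF Suc inverts_commutator] by (simp add: sg_def algebra_simps)
qed (use inverts_one in simp)

lemma inverts_b_pow: "inverts (int r, 0, 0, 0, int r) (- int r, 0, 0, 0, - int r)"
proof (induction r)
  case (Suc r)
  then show ?case using inverts_mult[OF Suc inverts_gen(2)] by (simp add: gen_b_def sg_def algebra_simps)
qed (use inverts_one in simp)

lemma inverts_a2_pow: "inverts (0, - int s, int s, 2 * int s, 0) (0, int s, - int s, - 2 * int s, 0)"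
proof (induction s)
  case (Suc s)
  then show ?case using inverts_mult[OF Suc inverts_a2] by (simp add: sg_def algebra_simps)
qed (use inverts_one in simp)

text \<open>The relation $[a^2, b]^e b^{Qe} a^{2je} = 1$ holds in the quotient, but its image under
  inverting the generators does not, because both commutators equal $z^{-1}$ up to the
  coordinate \<open>u\<close>.\<close>

lemma chirality_witness:
  assumes Q: "Q \<ge> 0" and j: "j \<ge> 0" and e: "e \<ge> 0" and p2: "p2 dvd 2 * e" and q2: "q2 dvd Q * e"
    and n: "\<not> n dvd 2 * e"
  shows "\<exists>x\<in>carrier GM. x \<noteq> \<one>\<^bsub>GM\<^esub> \<and> (\<one>\<^bsub>GM\<^esub>, x) \<in> inverting"
proof -
  \<comment> \<open>\<open>w1\<close> is the left-hand side of the relation and \<open>w2\<close>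
    the same word in the inverse generators, both multiplied out.\<close>
  define w1 where "w1 = (Q * e, - (j * e), - e + j * e, 4 * e + sg (Q * e) * (2 * (j * e)), Q * e)"
  define w2 where "w2 = (- (Q * e), j * e, - e - j * e, - 4 * e - sg (Q * e) * (2 * (j * e)), - (Q * e))"
  have "inverts (0, 0, - e, 4 * e, 0) (0, 0, - e, - 4 * e, 0)"
    using inverts_commutator_pow[of "nat e"] e by simp
  moreover have "inverts (Q * e, 0, 0, 0, Q * e) (- (Q * e), 0, 0, 0, - (Q * e))"
    using inverts_b_pow[of "nat (Q * e)"] Q e by simp
  moreover have "inverts (0, - (j * e), j * e, 2 * (j * e), 0) (0, j * e, - (j * e), - 2 * (j * e), 0)"
    using inverts_a2_pow[of "nat (j * e)"] j e by simp
  ultimately have "inverts w1 w2"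
    using inverts_mult[OF inverts_mult] unfolding w1_def w2_def by (fastforce simp: sg_def)
  then have w: "w1 \<in> carrier \<Gamma>" "w2 \<in> carrier \<Gamma>" "(proj w1, proj w2) \<in> inverting"
    by (auto simp: inverts_def)
  have je: "n dvd j * e" using n_j by simp
  have jQ: "q1 dvd (j * e) * Q" and jj: "h dvd (j * e) * j" using n_mult_Q[OF je] n_mult_j[OF je] .
  have u: "p2 dvd 4 * e + c * (2 * (j * e))" for c
  proof -
    have "p2 dvd 2 * (2 * e) + (c * j) * (2 * e)" by (rule dvd_add[OF dvd_mult[OF p2] dvd_mult[OF p2]])
    then show ?thesis by (simp add: algebra_simps)
  qed
  have "sim w1 (0, 0, 0, 0, 0)"
  proof -
    have "q1 dvd Q * e + (- e + j * e) * Q" using jQ by (simp add: algebra_simps)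
    moreover have "h dvd - (j * e) - (- e + j * e) * j" using jj by (simp add: algebra_simps)
    ultimately show ?thesis using u q2 by (simp add: w1_def)
  qed
  then have "proj w1 = \<one>\<^bsub>GM\<^esub>" using proj_eq_one w(1) by (simp add: M_def)
  moreover have "proj w2 \<noteq> \<one>\<^bsub>GM\<^esub>"
  proof
    assume "proj w2 = \<one>\<^bsub>GM\<^esub>"
    then have "sim w2 (0, 0, 0, 0, 0)" using proj_eq_one w(2) by (simp add: M_def)
    \<comment> \<open>In \<open>w1\<close> the power of $b$ and the commutator cancel once $z$ is
      eliminated. In \<open>w2\<close> they have the same sign and leave the exponent
      \<open>- 2 * e * Q\<close> modulo \<open>q1 = n * Q\<close>.\<close>
    then have "q1 dvd - (Q * e) + (- e - j * e) * Q" by (simp add: w2_def)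
    then have "q1 dvd (- (Q * e) + (- e - j * e) * Q) + (j * e) * Q" using jQ by (rule dvd_add)
    then have "q1 dvd - (2 * e * Q)" by (simp add: algebra_simps)
    then have "n * Q dvd 2 * e * Q" unfolding dvd_minus_iff by (simp add: q1_eq)
    moreover have "Q \<noteq> 0" using pos q1_eq by auto
    ultimately show False using n by simp
  qed
  ultimately show ?thesis using w by (metis proj.hom_closed)
qed

text \<open>The conditions on \<open>p\<close> and \<open>q\<close> describe them as least common
  multiples of \<open>2 * h\<close>, \<open>p2\<close> and of \<open>q1\<close>, \<open>q2\<close>.
  The exponent \<open>e\<close> of the failing relation must kill \<open>u\<close> and
  \<open>v\<close>, while \<open>2 * e\<close> survives modulo \<open>n\<close>.\<close>

lemma tight_chiral_GM:
  assumes "Q \<ge> 0" "j \<ge> 0" "e \<ge> 0" "p2 dvd 2 * e" "q2 dvd Q * e" "\<not> n dvd 2 * e"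
    and c: "c = q2 \<or> q2 = 2 * c \<and> odd c \<and> even q1 \<and> even Q" "c > 0"
    and p: "\<And>s. h dvd s \<and> p2 dvd 2 * s \<longleftrightarrow> int p dvd 2 * s" "even p" "p \<ge> 2"
    and q: "\<And>r. q1 dvd r \<and> q2 dvd r \<longleftrightarrow> int q dvd r" "q \<ge> 2"
    and order: "q1 * h * p2 * c = int p * int q"
  shows "tight_chiral_group GM (proj gen_a) (proj gen_b) p q"
proof -
  have fin: "finite (carrier GM)" and "int (order GM) \<le> int p * int q"
    using order_GM[OF c] order by auto
  then have ord_le: "order GM \<le> p * q" by (metis of_nat_le_iff of_nat_mult)
  have pow: "proj x [^]\<^bsub>GM\<^esub> (m::nat) = \<one>\<^bsub>GM\<^esub> \<longleftrightarrow> x [^]\<^bsub>\<Gamma>\<^esub> m \<in> M" if "x \<in> carrier \<Gamma>" for x m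
    using that proj_eq_one[of "x [^]\<^bsub>\<Gamma>\<^esub> m"] proj.hom_nat_pow[of x m] by simp
  have a_pow: "gen_a [^]\<^bsub>\<Gamma>\<^esub> m \<in> M \<longleftrightarrow> p dvd m" for m :: nat
  proof (cases "even m")
    case True
    then obtain s where s: "m = 2 * s" by blast
    have "gen_a [^]\<^bsub>\<Gamma>\<^esub> m \<in> M \<longleftrightarrow> int p dvd 2 * int s" unfolding s gen_a_pow_M p(1) ..
    also have "\<dots> \<longleftrightarrow> p dvd m" unfolding s by (metis of_nat_dvd_iff of_nat_mult of_nat_numeral)
    finally show ?thesis .
  next
    case False
    then obtain s where s: "m = Suc (2 * s)" by (metis oddE Suc_eq_plus1)
    have "\<not> p dvd m" using False p(2) dvd_trans by blast
    then show ?thesis using gen_a_pow_odd_M s by simp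
  qed
  have ord_a: "GM.ord (proj gen_a) = p"
    using a_pow pow by (simp add: GM.ord_unique)
  have ord_b: "GM.ord (proj gen_b) = q"
    using gen_b_pow_M pow q(1) by (simp add: GM.ord_unique)
  have ab: "proj gen_a \<noteq> \<one>\<^bsub>GM\<^esub>" "proj gen_b \<noteq> \<one>\<^bsub>GM\<^esub>"
    using ord_a ord_b p(3) q(2) GM.ord_eq_1[of "proj gen_a"] GM.ord_eq_1[of "proj gen_b"] by auto
  have "proj gen_a \<otimes>\<^bsub>GM\<^esub> proj gen_b = proj (quint_mult gen_a gen_b)"
    using proj.hom_mult[of gen_a gen_b] by simp
  then have "(proj gen_a \<otimes>\<^bsub>GM\<^esub> proj gen_b) \<otimes>\<^bsub>GM\<^esub> (proj gen_a \<otimes>\<^bsub>GM\<^esub> proj gen_b) =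
      proj (quint_mult (quint_mult gen_a gen_b) (quint_mult gen_a gen_b))"
    using proj.hom_mult[of "quint_mult gen_a gen_b" "quint_mult gen_a gen_b"]
    by (simp add: quint_mult_closed)
  also have "\<dots> = \<one>\<^bsub>GM\<^esub>" using proj.hom_one unfolding gen_involution by simp
  finally have invol: "(proj gen_a \<otimes>\<^bsub>GM\<^esub> proj gen_b) \<otimes>\<^bsub>GM\<^esub> (proj gen_a \<otimes>\<^bsub>GM\<^esub> proj gen_b) = \<one>\<^bsub>GM\<^esub>" .
  have "x = \<one>\<^bsub>GM\<^esub>" if x: "x \<in> generate GM {proj gen_a}" "x \<in> generate GM {proj gen_b}" for x
  proof -
    obtain s :: nat where s: "x = proj gen_a [^]\<^bsub>GM\<^esub> s"
      using x(1) GM.generate_pow_on_finite_carrier[OF fin, of "proj gen_a"] by auto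
    obtain r :: nat where r: "x = proj gen_b [^]\<^bsub>GM\<^esub> r"
      using x(2) GM.generate_pow_on_finite_carrier[OF fin, of "proj gen_b"] by auto
    have "proj (gen_a [^]\<^bsub>\<Gamma>\<^esub> s) = proj (gen_b [^]\<^bsub>\<Gamma>\<^esub> r)" using s r by (simp add: proj.hom_nat_pow)
    then have "sim (gen_a [^]\<^bsub>\<Gamma>\<^esub> s) (gen_b [^]\<^bsub>\<Gamma>\<^esub> r)" using proj_eq by simp
    then show ?thesis using gen_pow_sim pow s by simp
  qed
  then have "generate GM {proj gen_a} \<inter> generate GM {proj gen_b} = {\<one>\<^bsub>GM\<^esub>}"
    using generate.one by blast
  then show ?thesis
    unfolding tight_chiral_group_def
    using GM.is_group fin ord_le ab ord_a ord_b invol chirality_witness[OF assms(1-6)] by simp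
qed

end

section \<open>The admissible types\<close>

definition tight_chiral_types :: "nat \<Rightarrow> nat \<Rightarrow> bool" where
  "tight_chiral_types p q \<longleftrightarrow> (\<exists>P :: nat ranked_poset. tight_chiral_polyhedron P p q) \<and>
     (\<exists>P :: nat ranked_poset. tight_chiral_polyhedron P q p)"

lemma tight_chiral_types_sym: "tight_chiral_types p q \<Longrightarrow> tight_chiral_types q p"
  by (simp add: tight_chiral_types_def)

lemma tight_chiral_types_group: "tight_chiral_group G a b p q \<Longrightarrow> tight_chiral_types p q"
  unfolding tight_chiral_types_def
  using tight_chiral_group_polyhedron[of G a b p q]
    tight_chiral_group_polyhedron[OF tight_chiral_group_dual[of G a b p q]] by blast

lemma mult_dvd_iff: "coprime x y \<Longrightarrow> x * y dvd z \<longleftrightarrow> x dvd z \<and> y dvd (z :: int)"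
  by (meson divides_mult dvd_mult_left dvd_mult_right)

text \<open>The quotient with \<open>n = m\<close> and \<open>c = q2\<close>. Coprimality lets the
  orders multiply, and $m^2$ dividing \<open>q1\<close> makes \<open>m\<close> divide
  \<open>Q\<close> and \<open>j\<close>.\<close>

lemma odd_types:
  fixes h q1 p2 q2 m :: nat
  assumes m: "prime m" "m dvd h" "m\<^sup>2 dvd q1" "\<not> m dvd p2 * q2" and h: "h dvd q1" and odd: "odd q1"
    and p2: "even p2" "p2 > 0" "coprime h p2" and q2: "even q2 \<or> p2 = 2" "q2 > 0" "coprime q1 q2"
  shows "tight_chiral_types (h * p2) (q1 * q2)"
proof -
  have odd_h: "odd h" using odd h by (meson dvd_trans)
  then have odd_m: "odd m" using m by (meson dvd_trans)
  have pos: "m > 0" "q1 > 0" "h > 0" using m(1) odd odd_h by (auto intro: prime_gt_0_nat odd_pos)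
  obtain R where R: "q1 = m\<^sup>2 * R" using m(3) by blast
  define Q where "Q = m * R"
  have Q: "q1 = m * Q" by (simp add: R Q_def power2_eq_square)
  have m_le: "2 \<le> m" "m \<le> q1" using prime_ge_2_nat[OF m(1)] dvd_imp_le[of m q1] Q pos by auto
  \<comment> \<open>\<open>(h + 1) div 2\<close> is the inverse of 2 modulo the odd number
    \<open>h\<close>, so \<open>2 * j\<close> is congruent to \<open>Q\<close>.\<close>
  define j where "j = Q * ((h + 1) div 2)"
  have j: "2 * j = Q * (h + 1)"
    using odd_h by (elim oddE) (simp add: j_def algebra_simps)
  have nj: "m * j = q1 * ((h + 1) div 2)" by (simp add: j_def Q)
  interpret cover_quotient "int h" "int q1" "int p2" "int q2" "int m" "int Q" "int j"
  proof
    show "int h dvd int q1" using h by simp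
    have "int m * int j = int q1 * int ((h + 1) div 2)" using arg_cong[OF nj, of int] by simp
    then show "int h dvd int m * int j" using h by (simp add: dvd_mult2)
    have "int Q - 2 * int j = - (int h * int Q)"
      using arg_cong[OF j, of int] by (simp add: algebra_simps)
    then show "int h dvd int Q - 2 * int j" by simp
    show "int m dvd int j" by (simp add: j_def Q_def)
  qed (use m h pos odd_m p2 q2 in \<open>simp_all add: Q Q_def\<close>)
  have "coprime (int h) 2" using odd_h by simp
  then have p: "int h dvd s \<and> int p2 dvd 2 * s \<longleftrightarrow> int (h * p2) dvd 2 * s" for s
    using mult_dvd_iff[of "int h" "int p2" "2 * s"] p2(3) coprime_dvd_mult_right_iff[of "int h" 2 s] by simp
  have q: "int q1 dvd r \<and> int q2 dvd r \<longleftrightarrow> int (q1 * q2) dvd r" for r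
    using mult_dvd_iff[of "int q1" "int q2" r] q2(3) by simp
  \<comment> \<open>The relation exponent is \<open>p2 * q2\<close>, a multiple of both
    moduli.\<close>
  have m2: "\<not> int m dvd 2 * int (p2 * q2)"
  proof
    assume "int m dvd 2 * int (p2 * q2)"
    moreover have "coprime (int m) 2" using odd_m by simp
    ultimately have "int m dvd int (p2 * q2)" by (simp only: coprime_dvd_mult_right_iff)
    then show False using m(4) by (simp only: of_nat_dvd_iff)
  qed
  have "p2 \<ge> 2" using p2 by presburger
  then have "h * p2 \<ge> 2" using mult_le_mono[of 1 h 2 p2] pos by simp
  moreover have "q1 * q2 \<ge> 2" using m_le mult_le_mono[of 2 q1 1 q2] q2(2) by simp
  ultimately have "tight_chiral_group GM (proj gen_a) (proj gen_b) (h * p2) (q1 * q2)"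
    using p2(1) q2(2) by (intro tight_chiral_GM[OF _ _ _ _ _ m2 _ _ p _ _ q, of "int q2"]) simp_all
  then show ?thesis by (rule tight_chiral_types_group)
qed

text \<open>The quotient with \<open>n = 4\<close> and \<open>Q = 2 * j\<close>. The bound on
  \<open>A\<close> is the requirement \<open>h dvd n * j\<close>, that is, $2^{A+2}$ divides
  $2^{B+4}$. Both \<open>q1\<close> and \<open>q2\<close> are even here, so the order is bounded
  with \<open>c = q'\<close>.\<close>

lemma two_power_types:
  fixes A B p' q' :: nat
  assumes odd: "odd p'" "odd q'" and AB: "A \<le> B + 2"
  shows "tight_chiral_types (8 * 2 ^ A * p') (32 * 2 ^ B * q')"
proof -
  have pos: "p' > 0" "q' > 0" using odd by (auto intro: odd_pos)
  have pow: "4 * 2 ^ A dvd 16 * (2 ^ B :: int)"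
    using le_imp_power_dvd[of "A + 2" "B + 4" "2 :: int"] AB by (simp add: power_add mult.commute)
  then have pow': "4 * 2 ^ A dvd 32 * (2 ^ B :: int)"
    by (rule dvd_trans) (intro mult_dvd_mono; simp)
  interpret cover_quotient "4 * 2 ^ A" "32 * 2 ^ B" "2 * int p'" "2 * int q'" 4 "8 * 2 ^ B" "4 * 2 ^ B"
    by unfold_locales (use pow pow' pos in simp_all)
  have cop: "coprime (2 ^ k) (int p')" "coprime (2 ^ k) (int q')" for k
    using odd by simp_all
  have p: "4 * 2 ^ A dvd s \<and> 2 * int p' dvd 2 * s \<longleftrightarrow> int (8 * 2 ^ A * p') dvd 2 * s" for s
  proof -
    have "4 * 2 ^ A dvd s \<and> int p' dvd s \<longleftrightarrow> (4 * 2 ^ A) * int p' dvd s"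
      using mult_dvd_iff[of "4 * 2 ^ A" "int p'" s] cop(1)[of "A + 2"] by (simp add: power_add mult.commute)
    also have "\<dots> \<longleftrightarrow> 2 * ((4 * 2 ^ A) * int p') dvd 2 * s" unfolding dvd_mult_cancel_left by simp
    finally show ?thesis by (simp add: mult.assoc)
  qed
  have q: "32 * 2 ^ B dvd r \<and> 2 * int q' dvd r \<longleftrightarrow> int (32 * 2 ^ B * q') dvd r" for r
  proof -
    have "32 * 2 ^ B dvd r \<and> int q' dvd r \<longleftrightarrow> (32 * 2 ^ B) * int q' dvd r"
      using mult_dvd_iff[of "32 * 2 ^ B" "int q'" r] cop(2)[of "B + 5"] by (simp add: power_add mult.commute)
    moreover have "2 * int q' dvd r" if "(32 * 2 ^ B) * int q' dvd r"
      by (rule dvd_trans[OF _ that]) (intro mult_dvd_mono; simp)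
    moreover have "int q' dvd r" if "2 * int q' dvd r" using that by (rule dvd_mult_right)
    ultimately show ?thesis by auto
  qed
  have "\<not> 4 dvd 2 * x" if "odd x" for x :: int using that by presburger
  \<comment> \<open>The relation exponent \<open>p' * q'\<close> is odd, so its double is nonzero
    modulo 4.\<close>
  then have n: "\<not> 4 dvd 2 * (int p' * int q')" using odd by simp
  have q2: "2 * int q' dvd 8 * 2 ^ B * (int p' * int q')"
    using mult_dvd_mono[of 2 "8 * 2 ^ B * int p'" "int q'" "int q'"] by (simp add: mult.assoc)
  have "8 * 2 ^ A * p' \<ge> 2" "32 * 2 ^ B * q' \<ge> 2"
    using pos by (simp_all add: Suc_le_eq)
  then have "tight_chiral_group GM (proj gen_a) (proj gen_b) (8 * 2 ^ A * p') (32 * 2 ^ B * q')"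
    using pos odd by (intro tight_chiral_GM[OF _ _ _ _ q2 n _ _ p _ _ q, of "int q'"]) simp_all
  then show ?thesis by (rule tight_chiral_types_group)
qed

text \<open>\<open>h\<close> and \<open>q1\<close> are taken as the full powers of \<open>m\<close>
  in \<open>p\<close> and \<open>q\<close>, which leaves even cofactors prime to \<open>m\<close>;
  \<open>le\<close> provides \<open>h dvd q1\<close>.\<close>

lemma even_types_ordered:
  fixes p q m :: nat
  assumes "even p" "even q" "p > 0" "q > 0" "prime m" "odd m" "m dvd p" "m\<^sup>2 dvd q"
    and le: "multiplicity m p \<le> multiplicity m q"
  shows "tight_chiral_types p q"
proof -
  have m: "\<not> is_unit m" "m \<noteq> 0" using \<open>prime m\<close> by (auto simp: prime_nat_iff)
  obtain p' where p': "p = m ^ multiplicity m p * p'" "\<not> m dvd p'"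
    using multiplicity_decompose'[of p m] m \<open>p > 0\<close> by auto
  obtain q' where q': "q = m ^ multiplicity m q * q'" "\<not> m dvd q'"
    using multiplicity_decompose'[of q m] m \<open>q > 0\<close> by auto
  let ?h = "m ^ multiplicity m p" and ?q1 = "m ^ multiplicity m q"
  have odd: "odd ?h" "odd ?q1" using \<open>odd m\<close> by simp_all
  have "even p'" using p'(1) \<open>even p\<close> odd by (metis even_mult_iff)
  have "even q'" using q'(1) \<open>even q\<close> odd by (metis even_mult_iff)
  have mp: "1 \<le> multiplicity m p" and mq: "2 \<le> multiplicity m q"
    using multiplicity_geI[of p m 1] multiplicity_geI[of q m 2] assms m by auto
  have "coprime m p'" "coprime m q'" using p' q' \<open>prime m\<close> by (simp_all add: prime_imp_coprime)
  moreover have "\<not> m dvd p' * q'" using p' q' \<open>prime m\<close> by (simp add: prime_dvd_mult_iff)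
  moreover have "m dvd ?h" using mp le_imp_power_dvd[of 1 _ m] by simp
  moreover have "p' > 0" "q' > 0" using p' q' assms by (auto intro!: gr0I)
  ultimately have "tight_chiral_types (?h * p') (?q1 * q')"
    using \<open>even p'\<close> \<open>even q'\<close> \<open>prime m\<close> odd mq le
    by (intro odd_types[of m]) (auto intro: le_imp_power_dvd)
  then show ?thesis using p' q' by simp
qed

text \<open>If \<open>m\<close> occurs more often in \<open>p\<close> than in \<open>q\<close>, then
  its square divides \<open>p\<close> too, and the roles of \<open>p\<close> and \<open>q\<close>
  can be exchanged.\<close>

lemma even_types:
  fixes p q m :: nat
  assumes "even p" "even q" "p > 0" "q > 0" "prime m" "odd m" "m dvd p" "m\<^sup>2 dvd q"
  shows "tight_chiral_types p q"
proof (cases "multiplicity m p \<le> multiplicity m q")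
  case False
  have m: "\<not> is_unit m" using \<open>prime m\<close> by (auto simp: prime_nat_iff)
  have "2 \<le> multiplicity m q" using multiplicity_geI[of q m 2] assms m by auto
  then have "m\<^sup>2 dvd p" using False by (intro multiplicity_dvd') simp
  moreover have "m dvd q" using \<open>m\<^sup>2 dvd q\<close> by (metis dvd_mult_left power2_eq_square)
  ultimately show ?thesis
    using even_types_ordered[of q p m] assms False tight_chiral_types_sym by simp
qed (use even_types_ordered assms in blast)

text \<open>For 2-parts $2^x$ and $2^y$ the bound \<open>A \<le> B + 2\<close> reads
  \<open>x \<le> y\<close>. When \<open>p\<close> has the larger 2-part, 32 divides \<open>p\<close>
  as well and the two are exchanged.\<close>

lemma div_8_32_types:
  fixes p q :: nat
  assumes "8 dvd p" "32 dvd q" "p > 0" "q > 0"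
  shows "tight_chiral_types p q"
proof -
  obtain p' where p': "p = 2 ^ multiplicity 2 p * p'" "odd p'"
    using multiplicity_decompose'[of p 2] \<open>p > 0\<close> by auto
  obtain q' where q': "q = 2 ^ multiplicity 2 q * q'" "odd q'"
    using multiplicity_decompose'[of q 2] \<open>q > 0\<close> by auto
  have mp: "3 \<le> multiplicity 2 p" and mq: "5 \<le> multiplicity 2 q"
    using multiplicity_geI[of p 2 3] multiplicity_geI[of q 2 5] assms by auto
  have core: "tight_chiral_types (2 ^ x * x') (2 ^ y * y')"
    if "odd x'" "odd y'" "3 \<le> x" "x \<le> y" "5 \<le> y" for x y x' y' :: nat
  proof -
    have "2 ^ x = 8 * (2 :: nat) ^ (x - 3)" "2 ^ y = 32 * (2 :: nat) ^ (y - 5)"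
      using that power_add[of "2 :: nat" 3 "x - 3"] power_add[of "2 :: nat" 5 "y - 5"] by simp_all
    then show ?thesis using two_power_types[of x' y' "x - 3" "y - 5"] that by simp
  qed
  show ?thesis
  proof (cases "multiplicity 2 p \<le> multiplicity 2 q")
    case True
    show ?thesis using core[OF p'(2) q'(2) mp True mq] unfolding p'(1)[symmetric] q'(1)[symmetric] .
  next
    case False
    then have "tight_chiral_types (2 ^ multiplicity 2 q * q') (2 ^ multiplicity 2 p * p')"
      using mq by (intro core q'(2) p'(2)) simp_all
    then show ?thesis unfolding p'(1)[symmetric] q'(1)[symmetric] by (rule tight_chiral_types_sym)
  qed
qed

theorem theorem3p15:
  fixes p q :: nat
  assumes "p \<ge> 2" and "q \<ge> 2"
    and "(odd q \<and> even p \<and> p dvd 2 * q \<and> (\<exists>m::nat. prime m \<and> odd m \<and> m dvd p \<and> m\<^sup>2 dvd q)) \<or>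
         (even p \<and> even q \<and> (\<exists>m::nat. prime m \<and> odd m \<and> m dvd p \<and> m\<^sup>2 dvd q)) \<or>
         (8 dvd p \<and> 32 dvd q)"
  shows "(\<exists>P :: nat ranked_poset. tight_chiral_polyhedron P p q) \<and>
         (\<exists>P :: nat ranked_poset. tight_chiral_polyhedron P q p)"
proof -
  consider m where "odd q" "even p" "p dvd 2 * q" "prime m" "odd m" "m dvd p" "m\<^sup>2 dvd q"
    | m where "even p" "even q" "prime m" "odd m" "m dvd p" "m\<^sup>2 dvd q"
    | "8 dvd p" "32 dvd q"
    using assms(3) by blast
  then have "tight_chiral_types p q"
  proof cases
    case (1 m)
    obtain h where h: "p = 2 * h" using \<open>even p\<close> by blast
    have "h dvd q" using 1 h by simp
    then have "odd h" using \<open>odd q\<close> by (meson dvd_trans)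
    have "coprime m 2" using \<open>odd m\<close> by simp
    then have "m dvd h" using 1 h by (simp add: coprime_dvd_mult_right_iff)
    have "\<not> m dvd 2" using 1 \<open>coprime m 2\<close> by (metis coprime_absorb_left not_prime_unit)
    then show ?thesis
      using odd_types[of m h q 2 1] 1 h \<open>h dvd q\<close> \<open>odd h\<close> \<open>m dvd h\<close> by (simp add: mult.commute)
  next
    case (2 m)
    then show ?thesis using even_types assms by simp
  next
    case 3
    then show ?thesis using div_8_32_types assms by simp
  qed
  then show ?thesis by (simp add: tight_chiral_types_def)
qed

end
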